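(* Let $(f_k)_{k\ge2}$ be complex numbers such that $F_\lambda(z)=\lambda(z+\sum_{k\ge2}f_kz^k)$ is defined and univalent on the unit disk for $\lambda\in\mathbb{C}^*$. Let $(M_j)_{j\ge0}$ be an increasing sequence of positive numbers with $\lim M_j=+\infty$, let $C_j:=C_{M_j}$, and let $r_j=e^{-(3M_j+b_1)}$, where $b_1$ is the universal constant described in the context. Then the linearization $H:\lambda\mapsto H_\lambda$ belongs to the space $\mathcal{M}((C_\ell),\mathbb{C}\{z\})$ of $\mathbb{C}\{z\}$-valued monogenic functions (defined with the radii $r_j$).
   Context: **Linearization.** For $\lambda\in\mathbb{C}$ not a root of unity, $H_\lambda(z)=z+\sum_{k\ge2}h_k(\lambda)z^k$ with $h_1=1$ and, for $k\ge2$, $$h_k(\lambda)=\frac{1}{\lambda^{k-1}-1}\sum_{j=2}^{k} f_j\sum_{\epsilon\in(\mathbb{Z}_+)^j,\ \epsilon_1+\dots+\epsilon_j=k}h_{\epsilon_1}(\lambda)\cdots h_{\epsilon_j}(\lambda),$$ $\mathbb{Z}_+$ being the positive integers. This also defines $H_0$; one sets $H_\infty(z)=z$. **Brjuno function.** For irrational $\alpha=[a_0,a_1,a_2,\dots]$ (continued fraction expansion) with convergents $p_k/q_k=[a_0,\dots,a_k]$, $\mathcal{B}(\alpha)=\sum_{k\ge0}\frac{\log a_{k+1}}{q_k}\in[0,+\infty]$; $\mathcal{B}(r)=+\infty$ for $r\in\mathbb{Q}$. $A_t=\{x\in\mathbb{R}/\mathbb{Z}:\mathcal{B}(x)>t\}$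 (open). **The set $C_M$.** Fix $\kappa\in\,]0,1[$. The diamond on an open interval $V=]\xi^-,\xi^+[$ in $\mathbb{R}/\mathbb{Z}$ is $\{z\in\mathbb{C}/\mathbb{Z}:\xi^-<\Re z<\xi^+,\ |\Im z|<\kappa\min(\Re z-\xi^-,\xi^+-\Re z)\}$. $K_M$ is the complement in $\mathbb{C}/\mathbb{Z}$ of the union of the diamonds on all connected components of $A_M$, and $C_M=\{e^{2\pi i\zeta}:\zeta\in K_M\}\cup\{0,\infty\}\subset\mathbb{P}^1\mathbb{C}$. **Constant $b_1$.** $b_1$ is a universal constant (independent of $M$ and of the germ) such that, for all $M>0$, the series $H_\lambda$ has radius of convergence at least $e^{-(M+b_1)}$ for all $\lambda\in C_M$, and $\max_{\lambda\in C_M}|h_k(\lambda)|\le e^{(M+b_1)k}$ for all $k\ge1$ (such a constant exists). **Spaces.** $\mathcal{H}^\infty(\mathbb{D}_r)$ is the Banach space of bounded holomorphic functions on $\{|z|<r\}$ with sup norm. For a complex Banach space $B$ and a compact $C\subset\mathbb{C}$, a continuous $f:C\to B$ is in $\mathcal{C}^1_{hol}(C,B)$ if there is a continuous $f^{(1)}:C\to B$ such that for all $\lambda\in C$, $\varepsilon>0$ there is $\delta>0$ with $\|f(\lambda_2)-f(\lambda_1)-f^{(1)}(\lambda_1)(\lambda_2-\lambda_1)\|\le\varepsilon|\lambda_1-\lambda_2|$ for all $\lambda_1,\lambda_2\in C$ with $|\lambda_i-\lambda|<\delta$; for compact $C\subset\mathbb{P}^1\mathbb{C}$ the same local condition is required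 in the standard charts ($\lambda$ near finite points, $1/\lambda$ near $\infty$). It is a Banach space with norm the maximum of $\sup_C\|f\|$, $\sup_C\|f^{(1)}\|$ and $\sup_{\lambda_1\ne\lambda_2}\|f(\lambda_2)-f(\lambda_1)-f^{(1)}(\lambda_1)(\lambda_2-\lambda_1)\|/|\lambda_1-\lambda_2|$. **Monogenic functions.** Put $B_\ell=\bigcap_{j=0}^\ell\mathcal{C}^1_{hol}(C_j,\mathcal{H}^\infty(\mathbb{D}_{r_j}))$, with norm the maximum over $0\le j\le\ell$ of the norms in $\mathcal{C}^1_{hol}(C_j,\mathcal{H}^\infty(\mathbb{D}_{r_j}))$. $\mathcal{M}((C_\ell),\mathbb{C}\{z\})$ is the projective limit $\varprojlim B_\ell$, a Fréchet space; as a set it consists of all functions $f$ defined on $\bigcup_jC_j$, with values in germs $\mathbb{C}\{z\}$, such that for every $j$ the restriction $f|_{C_j}$ belongs to $\mathcal{C}^1_{hol}(C_j,\mathcal{H}^\infty(\mathbb{D}_{r_j}))$. *)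

theory Defs
  imports "HOL-Complex_Analysis.Complex_Analysis"
begin

fun cfrac_remainder :: "real \<Rightarrow> nat \<Rightarrow> real" where
  "cfrac_remainder \<alpha> 0 = \<alpha>"
| "cfrac_remainder \<alpha> (Suc k) = 1 / frac (cfrac_remainder \<alpha> k)"

definition partial_quotient :: "real \<Rightarrow> nat \<Rightarrow> int" where
  "partial_quotient \<alpha> k = \<lfloor>cfrac_remainder \<alpha> k\<rfloor>"

fun cfrac_value :: "int list \<Rightarrow> rat" where
  "cfrac_value [] = 0"
| "cfrac_value [a] = of_int a"
| "cfrac_value (a # b # as) = of_int a + 1 / cfrac_value (b # as)"

definition convergent_denom :: "real \<Rightarrow> nat \<Rightarrow> int" where
  "convergent_denom \<alpha> k =
     snd (quotient_of (cfrac_value (map (partial_quotient \<alpha>) [0..<Suc k])))"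

definition brjuno :: "real \<Rightarrow> ereal" where
  "brjuno \<alpha> = (if \<alpha> \<in> \<rat> then \<infinity> else
     (\<Sum>k. ereal (ln (of_int (partial_quotient \<alpha> (Suc k))) / of_int (convergent_denom \<alpha> k))))"

text \<open>
  Subsets of the circle \<open>\<real>/\<int>\<close> and of the cylinder \<open>\<complex>/\<int>\<close> are represented by their
  full preimages in \<open>\<real>\<close> and \<open>\<complex>\<close>. For \<open>M > 0\<close> the golden mean and its integer translates
  lie outside \<open>A_M\<close> (there the Brjuno function vanishes), so every component of the
  preimage is a bounded interval and maps bijectively to a component in the circle.
\<close>

definition brjuno_superlevel :: "real \<Rightarrow> real set" where
  "brjuno_superlevel t = {x. ereal t < brjuno x}"

definition diamond :: "real \<Rightarrow> real set \<Rightarrow> complex set" where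
  "diamond \<kappa> V = {z. Inf V < Re z \<and> Re z < Sup V \<and>
     \<bar>Im z\<bar> < \<kappa> * min (Re z - Inf V) (Sup V - Re z)}"

definition K_set :: "real \<Rightarrow> real \<Rightarrow> complex set" where
  "K_set \<kappa> M = - (\<Union>V\<in>components (brjuno_superlevel M). diamond \<kappa> V)"

text \<open>\<open>None\<close> is the point at infinity.\<close>

type_synonym riemann_sphere = "complex option"

definition C_set :: "real \<Rightarrow> real \<Rightarrow> riemann_sphere set" where
  "C_set \<kappa> M = (\<lambda>\<zeta>. Some (exp (2 * of_real pi * \<i> * \<zeta>))) ` K_set \<kappa> M \<union> {Some 0, None}"

text \<open>Germs of holomorphic functions at \<open>0\<close> are identified with convergent power series.\<close>

definition germs :: "complex fps set" where
  "germs = {F. 0 < fps_conv_radius F}"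

definition germ_family :: "(nat \<Rightarrow> complex) \<Rightarrow> complex \<Rightarrow> complex fps" where
  "germ_family f lam = fps_const lam *
     Abs_fps (\<lambda>k. if k = 0 then 0 else if k = 1 then 1 else f k)"

definition univalent_on_unit_disk :: "complex fps \<Rightarrow> bool" where
  "univalent_on_unit_disk F \<longleftrightarrow> 1 \<le> fps_conv_radius F \<and> inj_on (eval_fps F) (ball 0 1)"

definition compositions :: "nat \<Rightarrow> nat \<Rightarrow> nat list set" where
  "compositions j k = {\<epsilon>. length \<epsilon> = j \<and> (\<forall>i\<in>set \<epsilon>. 0 < i) \<and> sum_list \<epsilon> = k}"

lemma compositions_less:
  assumes "\<epsilon> \<in> compositions j k" "2 \<le> j" "i \<in> set \<epsilon>"
  shows "i < k"
proof -
  from assms(3) obtain xs ys where eps: "\<epsilon> = xs @ i # ys"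
    by (meson split_list)
  with assms(1,2) have "xs \<noteq> [] \<or> ys \<noteq> []" and pos: "\<forall>x\<in>set xs \<union> set ys. 0 < x"
    by (auto simp: compositions_def)
  then have "0 < sum_list xs + sum_list ys"
    by (cases xs; cases ys) auto
  with assms(1) eps show ?thesis
    by (auto simp: compositions_def)
qed

function lin_coeff :: "(nat \<Rightarrow> complex) \<Rightarrow> complex \<Rightarrow> nat \<Rightarrow> complex" where
  "lin_coeff f lam k =
     (if k = 0 then 0 else if k = 1 then 1 else
        1 / (lam ^ (k - 1) - 1) *
        (\<Sum>j=2..k. f j * (\<Sum>\<epsilon>\<in>compositions j k. \<Prod>i\<leftarrow>\<epsilon>. lin_coeff f lam i)))"
  by pat_completeness auto
termination
  by (relation "Wellfounded.measure (\<lambda>(f, lam, k). k)") (auto intro: compositions_less)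

declare lin_coeff.simps [simp del]

fun linearization :: "(nat \<Rightarrow> complex) \<Rightarrow> riemann_sphere \<Rightarrow> complex fps" where
  "linearization f (Some lam) = Abs_fps (lin_coeff f lam)"
| "linearization f None = fps_X"

text \<open>
  The constant \<open>b\<close> must serve for all \<open>M\<close> and all germs simultaneously; it may depend on \<open>\<kappa>\<close>.
  At roots of unity \<open>lin_coeff\<close> divides by zero, but these never lie in \<open>C_set \<kappa> M\<close>: the Brjuno
  function is infinite at rational points.
\<close>

definition linearization_constant :: "real \<Rightarrow> real \<Rightarrow> bool" where
  "linearization_constant \<kappa> b \<longleftrightarrow>
     (\<forall>f M. (\<forall>lam. lam \<noteq> 0 \<longrightarrow> univalent_on_unit_disk (germ_family f lam)) \<longrightarrow> 0 < M \<longrightarrow>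
        (\<forall>lam\<in>C_set \<kappa> M.
           ereal (exp (- (M + b))) \<le> fps_conv_radius (linearization f lam) \<and>
           (\<forall>k\<ge>1. cmod (fps_nth (linearization f lam) k) \<le> exp ((M + b) * real k))))"

text \<open>
  Bounded holomorphic functions on the disk of radius \<open>r\<close>, viewed as germs at \<open>0\<close>.
\<close>

definition H_inf :: "real \<Rightarrow> complex fps set" where
  "H_inf r = {F. \<exists>g. g holomorphic_on ball 0 r \<and> bounded (g ` ball 0 r) \<and> g has_fps_expansion F}"

definition H_inf_norm :: "real \<Rightarrow> complex fps \<Rightarrow> real" where
  "H_inf_norm r F = (SUP z\<in>ball 0 r. cmod (eval_fps F z))"

lemma H_inf_iff:
  assumes "0 < r"
  shows "F \<in> H_inf r \<longleftrightarrow> ereal r \<le> fps_conv_radius F \<and> bounded (eval_fps F ` ball 0 r)"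
proof
  assume "F \<in> H_inf r"
  then obtain g where g: "g holomorphic_on ball 0 r" "bounded (g ` ball 0 r)" "g has_fps_expansion F"
    by (auto simp: H_inf_def)
  have "eval_fps F ` ball 0 r = g ` ball 0 r"
    using has_fps_expansion_imp_eval_fps_eq[OF g(3) _ g(1)] by (intro image_cong) auto
  moreover have "ereal r \<le> fps_conv_radius F"
    using g by (intro holomorphic_on_imp_fps_conv_radius_ge[of g]) auto
  ultimately show "ereal r \<le> fps_conv_radius F \<and> bounded (eval_fps F ` ball 0 r)"
    using g(2) by simp
next
  assume F: "ereal r \<le> fps_conv_radius F \<and> bounded (eval_fps F ` ball 0 r)"
  have "ball (0::complex) r \<subseteq> eball 0 (fps_conv_radius F)"
  proof
    fix z :: complex
    assume "z \<in> ball 0 r"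
    then have "ereal (norm z) < ereal r" by simp
    also have "\<dots> \<le> fps_conv_radius F" using F by simp
    finally show "z \<in> eball 0 (fps_conv_radius F)" by (simp add: in_eball_iff)
  qed
  then have "eval_fps F holomorphic_on ball 0 r"
    by (rule holomorphic_on_eval_fps)
  moreover have "0 < fps_conv_radius F"
    using F assms less_le_trans[of 0 "ereal r" "fps_conv_radius F"] by simp
  then have "eval_fps F has_fps_expansion F"
    by (simp add: has_fps_expansion_def)
  ultimately show "F \<in> H_inf r"
    using F by (auto simp: H_inf_def)
qed

text \<open>
  The space \<open>C^1_hol(S, B)\<close>, for a complex normed space \<open>B\<close> given by a carrier, a scalar
  multiplication and a norm. The conditions are local, so \<open>S\<close> may be any subset of \<open>\<complex>\<close>;
  noncompact sets occur as coordinate images of compact subsets of the Riemann sphere.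
\<close>

definition norm_continuous_on :: "('b::ab_group_add \<Rightarrow> real) \<Rightarrow> complex set \<Rightarrow> (complex \<Rightarrow> 'b) \<Rightarrow> bool" where
  "norm_continuous_on N S f \<longleftrightarrow> (\<forall>lam\<in>S. ((\<lambda>\<mu>. N (f \<mu> - f lam)) \<longlongrightarrow> 0) (at lam within S))"

definition C1_hol ::
  "'b::ab_group_add set \<Rightarrow> (complex \<Rightarrow> 'b \<Rightarrow> 'b) \<Rightarrow> ('b \<Rightarrow> real) \<Rightarrow> complex set \<Rightarrow> (complex \<Rightarrow> 'b) set" where
  "C1_hol B smul N S = {f. f ` S \<subseteq> B \<and> norm_continuous_on N S f \<and>
     (\<exists>f1. f1 ` S \<subseteq> B \<and> norm_continuous_on N S f1 \<and>
        (\<forall>lam\<in>S. \<forall>\<epsilon>>0. \<exists>\<delta>>0. \<forall>lam1\<in>S. \<forall>lam2\<in>S. dist lam1 lam < \<delta> \<longrightarrow> dist lam2 lam < \<delta> \<longrightarrow>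
           N (f lam2 - f lam1 - smul (lam2 - lam1) (f1 lam1)) \<le> \<epsilon> * dist lam1 lam2))}"

definition chart_infinity :: "complex \<Rightarrow> riemann_sphere" where
  "chart_infinity w = (if w = 0 then None else Some (1 / w))"

definition C1_hol_sphere ::
  "'b::ab_group_add set \<Rightarrow> (complex \<Rightarrow> 'b \<Rightarrow> 'b) \<Rightarrow> ('b \<Rightarrow> real) \<Rightarrow>
   riemann_sphere set \<Rightarrow> (riemann_sphere \<Rightarrow> 'b) set" where
  "C1_hol_sphere B smul N C = {f.
     f \<circ> Some \<in> C1_hol B smul N (Some -` C) \<and>
     f \<circ> chart_infinity \<in> C1_hol B smul N (chart_infinity -` C)}"

definition monogenic ::
  "(nat \<Rightarrow> riemann_sphere set) \<Rightarrow> (nat \<Rightarrow> real) \<Rightarrow> (riemann_sphere \<Rightarrow> complex fps) set" where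
  "monogenic C r = {f \<in> (\<Union>j. C j) \<rightarrow>\<^sub>E germs.
     \<forall>j. f \<in> C1_hol_sphere (H_inf (r j)) (\<lambda>c F. fps_const c * F) (H_inf_norm (r j)) (C j)}"

end

theory Submission
  imports Defs "HOL-Real_Asymp.Real_Asymp"
begin

text \<open>
  Write \<open>h\<^sub>k\<close> for the \<open>k\<close>-th coefficient of the linearization. It is a rational function of the
  multiplier whose poles are roots of unity of order less than \<open>k\<close>. Membership in \<open>C^1_hol\<close> over
  \<open>C\<^sub>M\<close> with radius \<open>r = exp (-(3M + b))\<close> is obtained term by term in the series \<open>\<Sum>k. h\<^sub>k z^k\<close>: it
  suffices that every \<open>h\<^sub>k\<close> is holomorphic and bounded by \<open>m\<^sub>k\<close> on the disks of some radius \<open>\<rho>\<^sub>k\<close>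
  around the points of \<open>C\<^sub>M\<close> near a given point, with \<open>\<Sum>k. m\<^sub>k r^k / \<rho>\<^sub>k\<close> finite. Cauchy's estimate
  then bounds the derivative of \<open>h\<^sub>k\<close> and its Whitney difference quotient by multiples of
  \<open>m\<^sub>k / \<rho>\<^sub>k\<close>, and Tannery's theorem passes to the sum (\<open>C1_hol_power_series\<close>).

  The disks leave \<open>C\<^sub>M\<close>, so a bound on a larger set is needed. The constant \<open>b\<close> serves all \<open>M\<close>
  simultaneously; used for \<open>3M/2\<close> it gives \<open>\<bar>h\<^sub>k\<bar> \<le> m\<^sub>k = exp ((3M/2 + b) k)\<close> on the larger set
  \<open>C\<^bsub>3M/2\<^esub>\<close>. Of the diamonds that are removed from it, only those containing a fraction with
  denominator at most \<open>k\<close> can contain a pole of \<open>h\<^sub>k\<close>; over all others the maximum principle extends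
  the bound (\<open>K_set_maximum_principle\<close>). A diamond of the former kind lies in a diamond removed from
  \<open>C\<^sub>M\<close>, and it stays away from the boundary of the latter by a multiple of
  \<open>exp (-M k) / (k + 1)^3\<close> (\<open>component_margin\<close>, \<open>diamond_separation\<close>). With this as \<open>\<rho>\<^sub>k\<close> the series
  above is a multiple of \<open>\<Sum>k. (k + 1)^3 exp (-M k / 2)\<close> (\<open>local_bounds_in_chart\<close>).

  The separation of the diamonds is arithmetic (\<open>one_sided_approximation\<close>): between a number \<open>y\<close>
  with Brjuno value at most \<open>M\<close> and a fraction \<open>p/q\<close> with \<open>q \<le> k\<close> there is an \<open>x\<close> with Brjuno value
  at most \<open>3M/2\<close> that is not too close to \<open>y\<close>. Such an \<open>x\<close> arises by truncating the continued
  fraction of \<open>y\<close>, possibly changing the last entry, and appending the golden tail \<open>1, 1, 1, \<dots>\<close>,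
  which contributes nothing to the Brjuno function. If an intermediate fraction of \<open>y\<close> separates
  \<open>y\<close> from \<open>p/q\<close>, one truncates there. Otherwise a convergent \<open>p\<^sub>n/q\<^sub>n\<close> lies between them, and one
  replaces \<open>a\<^bsub>n+1\<^esub>\<close> by \<open>2 a\<^bsub>n+1\<^esub> + 1\<close>: this costs at most \<open>ln 3 / q\<^sub>n\<close> and, because
  \<open>a\<^bsub>n+1\<^esub> \<le> exp (M q\<^sub>n)\<close>, moves \<open>y\<close> by at least \<open>exp (-M q\<^sub>n) / (15 q\<^sub>n^2)\<close>.
\<close>

section \<open>Continued fractions\<close>

text \<open>
  Indices are shifted by two against the usual ones, \<open>p\<^sub>n = cf_num a (n + 2)\<close> and
  \<open>q\<^sub>n = cf_den a (n + 2)\<close>. The recursion then starts from \<open>0/1\<close> and \<open>1/0\<close>, and the values with no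
  partial quotient at all need no separate treatment.
\<close>

fun cf_num :: "(nat \<Rightarrow> int) \<Rightarrow> nat \<Rightarrow> int" where
  "cf_num a 0 = 0"
| "cf_num a (Suc 0) = 1"
| "cf_num a (Suc (Suc n)) = a n * cf_num a (Suc n) + cf_num a n"

fun cf_den :: "(nat \<Rightarrow> int) \<Rightarrow> nat \<Rightarrow> int" where
  "cf_den a 0 = 1"
| "cf_den a (Suc 0) = 0"
| "cf_den a (Suc (Suc n)) = a n * cf_den a (Suc n) + cf_den a n"

declare cf_num.simps(3) [simp del] cf_den.simps(3) [simp del]

text \<open>
  \<open>cf_val a m t\<close> is the continued fraction \<open>[a 0, \<dots>, a (m - 1), t]\<close>, as a Moebius function of its
  last entry; \<open>cf_val_den\<close> is the denominator of that function.
\<close>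

definition cf_val_den :: "(nat \<Rightarrow> int) \<Rightarrow> nat \<Rightarrow> real \<Rightarrow> real" where
  "cf_val_den a m t = of_int (cf_den a (Suc m)) * t + of_int (cf_den a m)"

definition cf_val :: "(nat \<Rightarrow> int) \<Rightarrow> nat \<Rightarrow> real \<Rightarrow> real" where
  "cf_val a m t = (of_int (cf_num a (Suc m)) * t + of_int (cf_num a m)) / cf_val_den a m t"

lemma cf_det: "cf_num a (Suc m) * cf_den a m - cf_num a m * cf_den a (Suc m) = (-1) ^ m"
  by (induction m) (auto simp: cf_num.simps(3) cf_den.simps(3) algebra_simps)

lemma cf_den_cong: "(\<And>i. i < m \<Longrightarrow> 0 < i \<Longrightarrow> a i = b i) \<Longrightarrow> cf_den a (Suc m) = cf_den b (Suc m)"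
proof (induction m rule: less_induct)
  case (less m)
  show ?case
  proof (cases m)
    case 0
    then show ?thesis by simp
  next
    case (Suc n)
    have 1: "cf_den a (Suc n) = cf_den b (Suc n)"
      using less.prems by (intro less.IH) (auto simp: Suc)
    have 2: "cf_den a n = cf_den b n"
    proof (cases n)
      case (Suc l)
      then show ?thesis
        using less.prems less.IH[of l] \<open>m = Suc n\<close> by auto
    qed auto
    have 3: "a n * cf_den b (Suc n) = b n * cf_den b (Suc n)"
      using less.prems[of n] by (cases "n = 0") (auto simp: Suc)
    show ?thesis
      using 1 2 3 by (simp add: Suc cf_den.simps(3))
  qed
qed

text \<open>
  The entry \<open>a 0\<close> is the integer part and may have any sign.
\<close>

definition cf_digits :: "(nat \<Rightarrow> int) \<Rightarrow> bool" where
  "cf_digits a \<longleftrightarrow> (\<forall>i>0. 1 \<le> a i)"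

lemma cf_digitsD: "cf_digits a \<Longrightarrow> 0 < i \<Longrightarrow> 1 \<le> a i"
  by (auto simp: cf_digits_def)

lemma cf_den_pos:
  assumes "cf_digits a"
  shows "0 < cf_den a (Suc (Suc m)) \<and> cf_den a (Suc m) \<le> cf_den a (Suc (Suc m)) \<and>
    0 \<le> cf_den a (Suc m) \<and> 0 \<le> cf_den a m"
proof (induction m)
  case (Suc m)
  have "1 * cf_den a (Suc (Suc m)) \<le> a (Suc m) * cf_den a (Suc (Suc m))"
    using cf_digitsD[OF assms, of "Suc m"] Suc by (intro mult_right_mono) auto
  then show ?case
    using Suc unfolding cf_den.simps(3)[of a "Suc m"] by linarith
qed (auto simp: cf_den.simps(3))

lemma cf_den_ge:
  assumes "cf_digits a"
  shows "int m \<le> cf_den a (Suc (Suc m)) \<and> 1 \<le> cf_den a (Suc (Suc m))"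
proof (induction m rule: less_induct)
  case (less m)
  show ?case
  proof (cases m)
    case (Suc n)
    show ?thesis
    proof (cases n)
      case (Suc l)
      have 1: "int n \<le> cf_den a (Suc (Suc n))" "1 \<le> cf_den a (Suc n)" 
        using less[of n] less[of l] \<open>m = Suc n\<close> Suc by auto
      have "1 * cf_den a (Suc (Suc n)) \<le> a (Suc n) * cf_den a (Suc (Suc n))"
        using cf_digitsD[OF assms, of "Suc n"] 1 by (intro mult_right_mono) auto
      then show ?thesis
        using 1 unfolding \<open>m = Suc n\<close> cf_den.simps(3)[of a "Suc n"] by linarith
    qed (use Suc cf_digitsD[OF assms, of 1] in \<open>auto simp: cf_den.simps(3)\<close>)
  qed (auto simp: cf_den.simps(3))
qed

lemma cf_val_den_pos:
  assumes "cf_digits a" "0 < t"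
  shows "0 < cf_val_den a m t"
proof (cases m)
  case (Suc n)
  have "0 < cf_den a (Suc (Suc n))" "0 \<le> cf_den a (Suc n)"
    using cf_den_pos[OF assms(1), where m = n] by auto
  then show ?thesis
    using assms(2) by (simp add: Suc cf_val_den_def add_pos_nonneg)
qed (use assms in \<open>auto simp: cf_val_den_def\<close>)

lemma cf_val_0 [simp]: "cf_val a 0 t = t"
  by (simp add: cf_val_def cf_val_den_def)

lemma cf_val_Suc:
  assumes "t \<noteq> 0"
  shows "cf_val a (Suc m) t = cf_val a m (of_int (a m) + 1 / t)"
proof -
  have "cf_val a m (of_int (a m) + 1 / t) =
      (t * (of_int (cf_num a (Suc m)) * (of_int (a m) + 1 / t) + of_int (cf_num a m))) /
      (t * cf_val_den a m (of_int (a m) + 1 / t))"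
    using assms by (simp add: cf_val_def)
  also have "\<dots> = cf_val a (Suc m) t"
    using assms by (simp add: cf_val_def cf_val_den_def cf_num.simps(3) cf_den.simps(3) algebra_simps)
  finally show ?thesis ..
qed

text \<open>
  The sign \<open>(-1)^m\<close> is the determinant of the Moebius transformation. It decides in which direction
  a change of the last entry leads, and the two denominators measure how far.
\<close>

lemma cf_val_diff:
  assumes "cf_digits a" "0 < t" "0 < s"
  shows "cf_val a m t - cf_val a m s = (-1) ^ m * (t - s) / (cf_val_den a m t * cf_val_den a m s)"
proof -
  let ?A = "real_of_int (cf_num a m)" and ?A' = "real_of_int (cf_num a (Suc m))"
  let ?B = "real_of_int (cf_den a m)" and ?B' = "real_of_int (cf_den a (Suc m))"
  have "cf_val_den a m t \<noteq> 0" "cf_val_den a m s \<noteq> 0"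
    using cf_val_den_pos[OF assms(1,2), where m = m] cf_val_den_pos[OF assms(1,3), where m = m] by auto
  then have "cf_val a m t - cf_val a m s =
      ((?A' * t + ?A) * (?B' * s + ?B) - (?A' * s + ?A) * (?B' * t + ?B)) /
      (cf_val_den a m t * cf_val_den a m s)"
    by (simp add: cf_val_def diff_frac_eq) (simp add: cf_val_den_def)
  also have "(?A' * t + ?A) * (?B' * s + ?B) - (?A' * s + ?A) * (?B' * t + ?B)
      = (?A' * ?B - ?A * ?B') * (t - s)"
    by (simp add: algebra_simps)
  also have "?A' * ?B - ?A * ?B' = of_int ((-1) ^ m)"
    unfolding cf_det[of a m, symmetric] by simp
  finally show ?thesis by simp
qed

lemma cf_val_minus_convergent:
  assumes "cf_digits a" "0 < t"
  shows "of_int (cf_num a (Suc (Suc m))) / of_int (cf_den a (Suc (Suc m))) - cf_val a (Suc m) t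
     = (-1) ^ Suc m / (of_int (cf_den a (Suc (Suc m))) * cf_val_den a (Suc m) t)"
proof -
  let ?A = "real_of_int (cf_num a (Suc m))" and ?A' = "real_of_int (cf_num a (Suc (Suc m)))"
  let ?B = "real_of_int (cf_den a (Suc m))" and ?B' = "real_of_int (cf_den a (Suc (Suc m)))"
  have "cf_val_den a (Suc m) t \<noteq> 0" "?B' \<noteq> 0"
    using cf_val_den_pos[OF assms, where m = "Suc m"] cf_den_pos[OF assms(1), where m = m]
    by (auto)
  then have "?A' / ?B' - cf_val a (Suc m) t =
      (?A' * (?B' * t + ?B) - (?A' * t + ?A) * ?B') / (?B' * cf_val_den a (Suc m) t)"
    unfolding cf_val_def by (subst diff_frac_eq) (simp_all add: cf_val_den_def)
  also have "?A' * (?B' * t + ?B) - (?A' * t + ?A) * ?B' = ?A' * ?B - ?A * ?B'"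
    by (simp add: algebra_simps)
  also have "\<dots> = of_int ((-1) ^ Suc m)"
    unfolding cf_det[of a "Suc m", symmetric] by simp
  finally show ?thesis by simp
qed

lemma cfrac_remainder_add: "cfrac_remainder x (Suc k) = cfrac_remainder (1 / frac x) k"
  by (induction k) auto

lemma cfrac_remainder_irrational: "x \<notin> \<rat> \<Longrightarrow> cfrac_remainder x k \<notin> \<rat>"
proof (induction k)
  case (Suc k)
  let ?t = "cfrac_remainder x k"
  show ?case
  proof
    assume "cfrac_remainder x (Suc k) \<in> \<rat>"
    then have "of_int \<lfloor>?t\<rfloor> + 1 / cfrac_remainder x (Suc k) \<in> \<rat>"
      by (intro Rats_add Rats_divide) auto
    then show False
      using Suc by (simp add: frac_def)
  qed
qed auto

lemma cfrac_remainder_gt_1: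
  assumes "x \<notin> \<rat>"
  shows "1 < cfrac_remainder x (Suc k)"
proof -
  have "frac (cfrac_remainder x k) \<noteq> 0"
    using cfrac_remainder_irrational[OF assms, of k] by (metis Ints_subset_Rats frac_eq_0_iff subsetD)
  then have "0 < frac (cfrac_remainder x k)"
    by (simp add: order_less_le)
  then show ?thesis
    using frac_lt_1[of "cfrac_remainder x k"] by simp
qed

lemma partial_quotient_ge_1: "x \<notin> \<rat> \<Longrightarrow> 0 < k \<Longrightarrow> 1 \<le> partial_quotient x k"
  using cfrac_remainder_gt_1[of x "k - 1"]
  unfolding partial_quotient_def by (cases k) (auto simp del: cfrac_remainder.simps)

lemma cf_digits_partial_quotient: "x \<notin> \<rat> \<Longrightarrow> cf_digits (partial_quotient x)"
  by (simp add: cf_digits_def partial_quotient_ge_1)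

lemma cfrac_remainder_step:
  "cfrac_remainder x k = of_int (partial_quotient x k) + 1 / cfrac_remainder x (Suc k)"
  by (simp add: partial_quotient_def frac_def)

lemma cfrac_remainder_bounds:
  assumes "x \<notin> \<rat>"
  shows "of_int (partial_quotient x k) < cfrac_remainder x k"
    and "cfrac_remainder x k < of_int (partial_quotient x k) + 1"
proof -
  have "0 < 1 / cfrac_remainder x (Suc k)" "1 / cfrac_remainder x (Suc k) < 1"
    using cfrac_remainder_gt_1[OF assms, of k] by (auto simp del: cfrac_remainder.simps)
  then show "of_int (partial_quotient x k) < cfrac_remainder x k"
    "cfrac_remainder x k < of_int (partial_quotient x k) + 1"
    using cfrac_remainder_step[of x k] by linarith+
qed

lemma cf_val_cfrac_remainder:
  assumes "x \<notin> \<rat>"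
  shows "cf_val (partial_quotient x) m (cfrac_remainder x m) = x"
proof (induction m)
  case (Suc m)
  have "cfrac_remainder x (Suc m) \<noteq> 0"
    using cfrac_remainder_gt_1[OF assms, of m] by linarith
  then show ?case
    using cf_val_Suc Suc cfrac_remainder_step[of x m] by metis
qed simp

text \<open>
  Since \<open>t > 1\<close>, the last entry can be absorbed into the one before: \<open>a m + 1/t\<close> has integer part
  \<open>a m\<close>, and its remainder is \<open>t\<close> again.
\<close>

lemma cf_val_expansion:
  assumes "cf_digits a" "1 < t"
  shows "cfrac_remainder (cf_val a m t) m = t \<and>
    (\<forall>i<m. partial_quotient (cf_val a m t) i = a i)"
  using assms(2)
proof (induction m arbitrary: t)
  case (Suc m)
  let ?u = "of_int (a m) + 1 / t"
  have eq: "cf_val a (Suc m) t = cf_val a m ?u"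
    using Suc.prems by (intro cf_val_Suc) auto
  have fl: "\<lfloor>?u\<rfloor> = a m"
    using Suc.prems by (intro floor_unique) auto
  have fr: "frac ?u = 1 / t"
    unfolding frac_def fl by simp
  have *: "cfrac_remainder (cf_val a m ?u) m = ?u \<and> (\<forall>i<m. partial_quotient (cf_val a m ?u) i = a i)"
  proof (cases m)
    case (Suc n)
    have "1 \<le> real_of_int (a m)" "0 < 1 / t"
      using cf_digitsD[OF assms(1), of m] Suc \<open>1 < t\<close> by auto
    then have "1 < ?u"
      by linarith
    then show ?thesis
      using Suc.IH by blast
  qed auto
  show ?case
    unfolding eq using * fl fr by (auto simp: less_Suc_eq partial_quotient_def)
qed auto

text \<open>
  The recursion from the front of the expansion, which is the one that \<open>cfrac_value\<close> follows.
\<close>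

lemma cf_num_den_Cons:
  assumes "\<And>i. b i = a (Suc i)"
  shows "cf_num a (Suc (Suc n)) = a 0 * cf_num b (Suc n) + cf_den b (Suc n)
   \<and> cf_den a (Suc (Suc n)) = cf_num b (Suc n)"
proof (induction n rule: less_induct)
  case (less n)
  consider "n = 0" | "n = 1" | l where "n = Suc (Suc l)"
    by (metis One_nat_def not0_implies_Suc)
  then show ?case
  proof cases
    case 3
    have "cf_num a (Suc (Suc n)) = a n * cf_num a (Suc (Suc (Suc l))) + cf_num a (Suc (Suc l))"
      "cf_den a (Suc (Suc n)) = a n * cf_den a (Suc (Suc (Suc l))) + cf_den a (Suc (Suc l))"
      "cf_num b (Suc n) = a n * cf_num b (Suc (Suc l)) + cf_num b (Suc l)"
      "cf_den b (Suc n) = a n * cf_den b (Suc (Suc l)) + cf_den b (Suc l)"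
      using 3 by (simp_all only: cf_num.simps cf_den.simps assms)
    then show ?thesis
      using less[of l] less[of "Suc l"] 3 by (auto simp: algebra_simps)
  qed (auto simp: cf_num.simps(3) cf_den.simps(3) assms)
qed

lemma cfrac_value_eq:
  assumes "cf_digits a"
  shows "cfrac_value (map a [0..<Suc n]) = of_int (cf_num a (Suc (Suc n))) / of_int (cf_den a (Suc (Suc n)))"
  using assms
proof (induction n arbitrary: a)
  case (Suc n)
  have "cfrac_value (map a [0..<Suc (Suc n)]) = cfrac_value (a 0 # map (a \<circ> Suc) [0..<Suc n])"
    by (simp add: upt_conv_Cons map_Suc_upt[symmetric] comp_assoc del: upt_Suc)
  also have "\<dots> = of_int (a 0) + 1 / cfrac_value (map (a \<circ> Suc) [0..<Suc n])"
    by (simp add: upt_conv_Cons del: upt_Suc)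
  also have "\<dots> = of_int (a 0) + 1 / (of_int (cf_num (a \<circ> Suc) (Suc (Suc n))) / of_int (cf_den (a \<circ> Suc) (Suc (Suc n))))"
    by (subst Suc.IH) (use Suc.prems in \<open>auto simp: cf_digits_def\<close>)
  also have "\<dots> = of_int (a 0) + of_int (cf_den (a \<circ> Suc) (Suc (Suc n))) / of_int (cf_num (a \<circ> Suc) (Suc (Suc n)))"
    by simp
  also have "\<dots> = of_int (cf_num a (Suc (Suc (Suc n)))) / of_int (cf_den a (Suc (Suc (Suc n))))"
  proof -
    have "cf_num (a \<circ> Suc) (Suc (Suc n)) > 0"
      using cf_num_den_Cons[of "a \<circ> Suc" a "Suc n"] cf_den_pos[OF Suc.prems, where m = "Suc n"] by simp
    then show ?thesis
      using cf_num_den_Cons[of "a \<circ> Suc" a "Suc n"]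
      by (simp add: add_divide_distrib)
  qed
  finally show ?case .
qed (auto simp: cf_num.simps(3) cf_den.simps(3))

lemma convergent_denom_eq:
  assumes "x \<notin> \<rat>"
  shows "convergent_denom x n = cf_den (partial_quotient x) (Suc (Suc n))"
proof -
  let ?a = "partial_quotient x"
  let ?p = "cf_num ?a (Suc (Suc n))" and ?q = "cf_den ?a (Suc (Suc n))"
  have pos: "0 < ?q"
    using cf_den_pos[OF cf_digits_partial_quotient[OF assms]] by blast
  have "coprime ?p ?q"
  proof (rule coprimeI)
    fix c assume "c dvd ?p" "c dvd ?q"
    then have "c dvd ?p * cf_den ?a (Suc n) - cf_num ?a (Suc n) * ?q"
      by (intro dvd_diff dvd_mult dvd_mult2)
    then show "c dvd 1"
      unfolding cf_det by (metis dvd_trans minus_one_mult_self dvd_triv_left)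
  qed
  then show ?thesis
    unfolding convergent_denom_def
    by (subst cfrac_value_eq)
       (use cf_digits_partial_quotient[OF assms] pos in
         \<open>auto simp: Fract_of_int_quotient[symmetric] quotient_of_Fract\<close>)
qed

section \<open>The Brjuno function and golden tails\<close>

text \<open>
  All partial quotients of the golden mean are \<open>1\<close>, so that their logarithms vanish.
\<close>

definition golden :: real where
  "golden = (1 + sqrt 5) / 2"

lemma golden_bounds: "3 / 2 < golden" "golden < 17 / 10"
proof -
  have "2 < sqrt 5"
    by (rule real_less_rsqrt) simp
  moreover have "sqrt 5 < 24 / 10"
    by (rule real_less_lsqrt) (simp_all add: power2_eq_square)
  ultimately
  show "3 / 2 < golden" "golden < 17 / 10"
    by (auto simp: golden_def)
qed

lemma golden_square: "golden * golden = golden + 1"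
  by (simp add: golden_def field_simps)

lemma inverse_golden: "1 / golden = golden - 1"
  using golden_square golden_bounds by (simp add: field_simps)

lemma golden_irrational: "golden \<notin> \<rat>"
proof
  assume "golden \<in> \<rat>"
  then obtain m n :: nat where n: "n \<noteq> 0" "golden = real m / real n" "coprime m n"
    by (rule Rats_abs_nat_div_natE) (use golden_bounds in auto)
  have "real m * real m = real m * real n + real n * real n"
  proof -
    have m: "real m = golden * real n"
      unfolding n(2) using n(1) by simp
    have "golden * golden * (real n * real n) = (golden + 1) * (real n * real n)"
      by (simp add: golden_square)
    then show ?thesis
      unfolding m by (simp add: algebra_simps)
  qed
  then have eq: "m * m = m * n + n * n"
    by (simp only: of_nat_add[symmetric] of_nat_mult[symmetric] of_nat_eq_iff)
  then have "n dvd m * m"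
    by simp
  then have "n = 1"
    using coprime_common_divisor[of "m * m" n n] n(3) by simp
  then have "m * m = m + 1"
    using eq by simp
  moreover have "m \<noteq> 0"
    using calculation by (rule contrapos_pn) simp
  moreover have "m \<noteq> 1"
    using calculation(1) by (rule contrapos_pn) simp
  ultimately have "2 \<le> m" "m * m = m + 1"
    by auto
  moreover from this have "2 * m \<le> m * m"
    by (intro mult_right_mono) auto
  ultimately show False
    by linarith
qed

lemma frac_add_int: "0 \<le> u \<Longrightarrow> u < 1 \<Longrightarrow> frac (of_int d + u) = (u::real)"
  using frac_unique_iff[of "of_int d + u" u] by auto

lemma cfrac_remainder_golden: "cfrac_remainder golden k = golden"
proof (induction k)
  case (Suc k)
  have "frac golden = 1 / golden"
    using frac_add_int[of "1 / golden" 1] golden_bounds by (simp add: inverse_golden)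
  then show ?case
    using Suc by simp
qed auto

lemma cfrac_remainder_rational: "x \<in> \<rat> \<Longrightarrow> cfrac_remainder x k \<in> \<rat>"
  by (induction k) (auto simp: frac_def)

lemma brjuno_term_nonneg:
  assumes "x \<notin> \<rat>"
  shows "0 \<le> ln (real_of_int (partial_quotient x (Suc k))) / real_of_int (convergent_denom x k)"
proof -
  have "0 < cf_den (partial_quotient x) (Suc (Suc k))" "1 \<le> partial_quotient x (Suc k)"
    using cf_den_pos[OF cf_digits_partial_quotient[OF assms]]
      cf_digitsD[OF cf_digits_partial_quotient[OF assms]] by auto
  then show ?thesis
    by (simp add: convergent_denom_eq[OF assms])
qed

lemma brjuno_partial_sum_le:
  assumes "brjuno x \<le> ereal M"
  shows "(\<Sum>k<n. ln (real_of_int (partial_quotient x (Suc k))) / real_of_int (convergent_denom x k)) \<le> M"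
proof -
  have x: "x \<notin> \<rat>"
    using assms by (auto simp: brjuno_def)
  have "(\<Sum>k<n. ereal (ln (real_of_int (partial_quotient x (Suc k))) / real_of_int (convergent_denom x k)))
      \<le> (\<Sum>k. ereal (ln (real_of_int (partial_quotient x (Suc k))) / real_of_int (convergent_denom x k)))"
    using brjuno_term_nonneg[OF x] by (intro sum_le_suminf summable_ereal_pos) auto
  also have "\<dots> \<le> ereal M"
    using assms x by (simp add: brjuno_def)
  finally show ?thesis
    by simp
qed

text \<open>
  The single term \<open>ln a\<^bsub>k+1\<^esub> / q\<^sub>k\<close> of the Brjuno series is at most \<open>M\<close>.
\<close>

lemma partial_quotient_le_exp:
  assumes "brjuno x \<le> ereal M"
  shows "real_of_int (partial_quotient x (Suc k)) \<le> exp (M * of_int (cf_den (partial_quotient x) (Suc (Suc k))))"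
proof -
  have x: "x \<notin> \<rat>"
    using assms by (auto simp: brjuno_def)
  let ?T = "\<lambda>k. ln (real_of_int (partial_quotient x (Suc k))) / real_of_int (convergent_denom x k)"
  have pos: "0 < cf_den (partial_quotient x) (Suc (Suc k))" "1 \<le> partial_quotient x (Suc k)"
    using cf_den_pos[OF cf_digits_partial_quotient[OF x]]
      cf_digitsD[OF cf_digits_partial_quotient[OF x]] by auto
  have "?T k \<le> sum ?T {..<Suc k}"
    using brjuno_term_nonneg[OF x] by (intro member_le_sum) auto
  also have "\<dots> \<le> M"
    by (rule brjuno_partial_sum_le[OF assms])
  finally have "ln (real_of_int (partial_quotient x (Suc k))) \<le> M * of_int (cf_den (partial_quotient x) (Suc (Suc k)))"
    using pos by (simp add: convergent_denom_eq[OF x] field_simps)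
  then show ?thesis
    using pos by (subst ln_le_cancel_iff[symmetric]) auto
qed

text \<open>
  By \<open>partial_quotient_le_exp\<close> a bound on the Brjuno function controls \<open>q\<^bsub>n+1\<^esub>\<close> in terms of \<open>q\<^sub>n\<close>.
  Iterating gives a bound for \<open>q\<^sub>n\<close> that depends on \<open>M\<close> and \<open>n\<close> alone.
\<close>

fun cf_den_bound :: "real \<Rightarrow> nat \<Rightarrow> real" where
  "cf_den_bound M 0 = 1"
| "cf_den_bound M (Suc n) = (exp (M * cf_den_bound M n) + 1) * cf_den_bound M n"

lemma cf_den_bound_mono: "1 \<le> cf_den_bound M n \<and> cf_den_bound M n \<le> cf_den_bound M (Suc n)"
proof (induction n)
  case (Suc n)
  let ?G = "cf_den_bound M (Suc n)"
  have "1 \<le> ?G"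
    using Suc by linarith
  moreover have "1 * ?G \<le> (exp (M * ?G) + 1) * ?G"
    using \<open>1 \<le> ?G\<close> by (intro mult_right_mono) auto
  ultimately show ?case
    by simp
qed auto

lemma cf_den_le_bound:
  assumes "brjuno x \<le> ereal M" "0 < M"
  shows "of_int (cf_den (partial_quotient x) (Suc (Suc n))) \<le> cf_den_bound M n"
proof (induction n)
  case (Suc n)
  let ?B = "cf_den (partial_quotient x)"
  let ?G = "cf_den_bound M n"
  have x: "x \<notin> \<rat>"
    using assms by (auto simp: brjuno_def)
  have pos: "?B (Suc n) \<le> ?B (Suc (Suc n))" "1 \<le> partial_quotient x (Suc n)" "0 < ?B (Suc (Suc n))"
    using cf_den_pos[OF cf_digits_partial_quotient[OF x]]
      cf_digitsD[OF cf_digits_partial_quotient[OF x]] by auto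
  have "partial_quotient x (Suc n) \<le> exp (M * ?B (Suc (Suc n)))"
    using assms by (intro partial_quotient_le_exp)
  also have "\<dots> \<le> exp (M * ?G)"
    using Suc assms by (simp add: mult_left_mono)
  finally have a: "partial_quotient x (Suc n) \<le> exp (M * ?G)" .
  have "?B (Suc (Suc (Suc n))) = partial_quotient x (Suc n) * ?B (Suc (Suc n)) + ?B (Suc n)"
    by (simp add: cf_den.simps(3))
  also have "real_of_int \<dots> \<le> (real_of_int (partial_quotient x (Suc n)) + 1) * real_of_int (?B (Suc (Suc n)))"
    using pos by (simp add: algebra_simps)
  also have "\<dots> \<le> (exp (M * ?G) + 1) * ?G"
    using a Suc pos by (intro mult_mono) auto
  finally show ?case by simp
qed (auto simp: cf_den.simps(3))

text \<open>
  The truncated series keeps the terms of \<open>y\<close> before index \<open>n\<close>. The term at \<open>n\<close> changes by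
  \<open>ln (d / a\<^bsub>n+1\<^esub>) / q\<^sub>n\<close>, and all later terms, which are nonnegative for \<open>y\<close>, are replaced by zero.
\<close>

lemma brjuno_golden_tail:
  assumes y: "brjuno y \<le> ereal M"
    and d: "1 \<le> d" and \<delta>: "0 \<le> \<delta>"
    and cost: "ln (of_int d / of_int (partial_quotient y (Suc n))) \<le> \<delta> * of_int (cf_den (partial_quotient y) (Suc (Suc n)))"
  shows "brjuno (cf_val (partial_quotient y) (Suc n) (of_int d + 1 / golden)) \<le> ereal (M + \<delta>)"
proof -
  let ?a = "partial_quotient y" and ?t = "of_int d + 1 / golden"
  define x where "x = cf_val ?a (Suc n) ?t"
  have g: "0 < 1 / golden" "1 / golden < 1"
    using golden_bounds by (auto simp: field_simps)
  have yirr: "y \<notin> \<rat>"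
    using y by (auto simp: brjuno_def)
  have "1 < ?t"
    using d g by linarith
  have rem: "cfrac_remainder x (Suc n) = ?t" and pq: "\<And>i. i < Suc n \<Longrightarrow> partial_quotient x i = ?a i"
    using cf_val_expansion[OF cf_digits_partial_quotient[OF yirr] \<open>1 < ?t\<close>] unfolding x_def by blast+
  have frac: "frac ?t = 1 / golden"
    using g by (intro frac_add_int) auto
  have rem': "cfrac_remainder x (Suc (Suc n)) = golden"
    unfolding cfrac_remainder.simps(2)[of x "Suc n"] rem frac by simp
  have xirr: "x \<notin> \<rat>"
    using cfrac_remainder_rational[of x "Suc (Suc n)"] golden_irrational rem' by auto
  have tail: "cfrac_remainder x (Suc (Suc n) + j) = golden" for j
  proof (induction j)
    case (Suc j)
    show ?case
      using Suc cfrac_remainder_golden[of "Suc 0"] by simp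
  qed (use rem' in simp)
  have pq_d: "partial_quotient x (Suc n) = d"
    unfolding partial_quotient_def rem using g by (intro floor_unique) auto
  have pq_1: "partial_quotient x i = 1" if "Suc n < i" for i
  proof -
    from that obtain j where "i = Suc (Suc n) + j"
      by (metis add_Suc less_iff_Suc_add)
    then show ?thesis
      unfolding partial_quotient_def using tail[of j] golden_bounds by (intro floor_unique) auto
  qed
  have den: "convergent_denom x k = convergent_denom y k" if "k \<le> n" for k
    unfolding convergent_denom_eq[OF xirr] convergent_denom_eq[OF yirr]
    using that by (intro cf_den_cong pq) auto
  define T where "T = (\<lambda>z k. ln (real_of_int (partial_quotient z (Suc k))) / real_of_int (convergent_denom z k))"
  have "brjuno x = (\<Sum>k. ereal (T x k))"
    using xirr by (simp add: brjuno_def T_def)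
  also have "\<dots> = (\<Sum>k\<le>n. ereal (T x k))"
    by (intro suminf_finite) (auto simp: T_def pq_1)
  also have "\<dots> = ereal (\<Sum>k\<le>n. T x k)"
    by simp
  also have "(\<Sum>k\<le>n. T x k) \<le> (\<Sum>k\<le>n. T y k) + \<delta>"
  proof -
    have "(\<Sum>k<n. T x k) = (\<Sum>k<n. T y k)"
      using pq den by (intro sum.cong) (auto simp: T_def)
    moreover have "T x n \<le> T y n + \<delta>"
    proof -
      have pos: "0 < cf_den ?a (Suc (Suc n))" "1 \<le> ?a (Suc n)"
        using cf_den_pos[OF cf_digits_partial_quotient[OF yirr]]
          cf_digitsD[OF cf_digits_partial_quotient[OF yirr]] by auto
      have "ln (real_of_int d) - ln (real_of_int (?a (Suc n))) \<le> \<delta> * cf_den ?a (Suc (Suc n))"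
        using cost d pos by (simp add: ln_div)
      then have "(ln (real_of_int d) - ln (real_of_int (?a (Suc n)))) / cf_den ?a (Suc (Suc n)) \<le> \<delta>"
        using pos by (simp add: field_simps)
      then show ?thesis
        by (simp add: T_def pq_d den convergent_denom_eq[OF yirr] diff_divide_distrib)
    qed
    ultimately show ?thesis
      by (simp add: lessThan_Suc_atMost[symmetric])
  qed
  also have "(\<Sum>k\<le>n. T y k) \<le> M"
    using brjuno_partial_sum_le[OF y, of "Suc n"] by (simp add: T_def lessThan_Suc_atMost)
  finally show ?thesis
    by (simp add: x_def)
qed

text \<open>
  These points lie in no superlevel set and therefore bound the lengths of the components.
\<close>

lemma brjuno_golden_translate: "brjuno (of_int m + golden) = 0"
proof -
  let ?x = "of_int m + golden"
  have irr: "?x \<notin> \<rat>"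
    using golden_irrational Rats_diff[of ?x "of_int m"] by auto
  have "frac ?x = 1 / golden"
    using frac_add_int[of "1 / golden" "m + 1"] golden_bounds by (simp add: inverse_golden)
  then have "1 / frac ?x = golden"
    by simp
  then have "partial_quotient ?x (Suc k) = 1" for k
    unfolding partial_quotient_def cfrac_remainder_add cfrac_remainder_golden
    using golden_bounds by (simp add: cfrac_remainder_golden floor_unique)
  then show ?thesis
    using irr by (simp add: brjuno_def zero_ereal_def[symmetric])
qed

section \<open>Approximation by numbers with small Brjuno value\<close>

text \<open>
  Odd convergents lie to the right of \<open>y\<close>, even ones to the left.
\<close>

lemma sign_convergent_minus:
  assumes "y \<notin> \<rat>"
  shows "0 < (-1) ^ Suc m * (of_int (cf_num (partial_quotient y) (Suc (Suc m))) / of_int (cf_den (partial_quotient y) (Suc (Suc m))) - y)"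
    and "(-1) ^ Suc m * (of_int (cf_num (partial_quotient y) (Suc (Suc m))) / of_int (cf_den (partial_quotient y) (Suc (Suc m))) - y)
      \<le> 1 / of_int (cf_den (partial_quotient y) (Suc (Suc m)))"
proof -
  let ?a = "partial_quotient y" and ?t = "cfrac_remainder y (Suc m)"
  let ?B = "real_of_int (cf_den ?a (Suc (Suc m)))"
  have dig: "cf_digits ?a"
    using assms by (rule cf_digits_partial_quotient)
  have t: "1 < ?t"
    using assms by (rule cfrac_remainder_gt_1)
  then have "0 < ?t" by linarith
  have eq: "(-1) ^ Suc m * (of_int (cf_num ?a (Suc (Suc m))) / ?B - y) = 1 / (?B * cf_val_den ?a (Suc m) ?t)"
    using cf_val_minus_convergent[OF dig \<open>0 < ?t\<close>, of m] cf_val_cfrac_remainder[OF assms, of "Suc m"]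
    by (simp add: power_mult_distrib[symmetric] flip: power_Suc)
  have B: "1 \<le> ?B" "0 \<le> cf_den ?a (Suc m)"
    using cf_den_ge[OF dig, of m] cf_den_pos[OF dig, of m] by auto
  have "1 * 1 \<le> ?B * ?t"
    using B t by (intro mult_mono) auto
  then have D: "1 \<le> cf_val_den ?a (Suc m) ?t"
    unfolding cf_val_den_def using B by simp
  show "0 < (-1) ^ Suc m * (of_int (cf_num ?a (Suc (Suc m))) / ?B - y)"
    unfolding eq using B D by simp
  have "?B * 1 \<le> ?B * cf_val_den ?a (Suc m) ?t"
    using B D by (intro mult_left_mono) auto
  then show "(-1) ^ Suc m * (of_int (cf_num ?a (Suc (Suc m))) / ?B - y) \<le> 1 / ?B"
    unfolding eq using B D by (intro divide_left_mono) auto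
qed

text \<open>
  Convergents and intermediate fractions are the best one-sided approximations of \<open>y\<close>. Let \<open>n\<close> be
  the first index, from \<open>n0\<close> on, of a convergent that lies on the same side of \<open>y\<close> as \<open>p/q\<close> and at
  least as near to \<open>y\<close>. In the basis formed by the convergents \<open>n - 1\<close> and \<open>n - 2\<close> the vector
  \<open>(p, q)\<close> has coordinates \<open>u, v \<ge> 1\<close>, because \<open>p/q\<close> lies strictly between these convergents.
  Lowering the coordinates to \<open>(c, 1)\<close> with \<open>c = min u a\<^sub>n\<close> only decreases the denominator and moves
  the fraction towards \<open>y\<close>; for \<open>c = a\<^sub>n\<close> it is the convergent \<open>n\<close> itself. The starting index \<open>n0\<close>
  serves to keep the denominators of the convergents large; if already \<open>n \<le> n0 + 1\<close>, the convergent \<open>n\<close>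
  is taken although its denominator may exceed \<open>q\<close>.
\<close>

lemma semiconvergent_between:
  fixes y :: real and p q s :: int and n0 :: nat
  assumes irr: "y \<notin> \<rat>" and s: "s = 1 \<or> s = -1" and q: "1 \<le> q"
    and side: "0 < of_int s * (of_int p / of_int q - y)"
  defines "A \<equiv> cf_num (partial_quotient y)" and "B \<equiv> cf_den (partial_quotient y)"
  obtains (convergent) n where "(-1) ^ Suc n = s" "n0 \<le> n"
      "0 \<le> s * (p * B (Suc (Suc n)) - q * A (Suc (Suc n)))"
      "B (Suc (Suc n)) \<le> q \<or> n \<le> Suc n0"
  | (intermediate) n c where "(-1) ^ n = s" "1 \<le> c" "c < partial_quotient y (Suc n)"
      "c * B (Suc (Suc n)) + B (Suc n) \<le> q"
      "0 \<le> s * (p * (c * B (Suc (Suc n)) + B (Suc n)) - q * (c * A (Suc (Suc n)) + A (Suc n)))"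
proof -
  let ?a = "partial_quotient y"
  have dig: "cf_digits ?a"
    using irr by (rule cf_digits_partial_quotient)
  define P where "P n \<longleftrightarrow> n0 \<le> n \<and> (-1) ^ Suc n = s \<and> 0 \<le> s * (p * B (Suc (Suc n)) - q * A (Suc (Suc n)))" for n
  have Bpos: "0 < B (Suc (Suc n))" for n
    using cf_den_pos[OF dig] by (simp add: B_def)
  have cross: "of_int (s * (p * B (Suc (Suc n)) - q * A (Suc (Suc n)))) =
     of_int s * (of_int p / of_int q - real_of_int (A (Suc (Suc n))) / of_int (B (Suc (Suc n)))) * (of_int q * of_int (B (Suc (Suc n))))" for n
  proof -
    have "real_of_int q \<noteq> 0" "real_of_int (B (Suc (Suc n))) \<noteq> 0"
      using q Bpos[of n] by auto
    then show ?thesis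
      by (simp add: diff_frac_eq)
  qed
  obtain N where "1 / (of_int s * (of_int p / of_int q - y)) \<le> real N"
    using real_arch_simple by blast
  \<comment> \<open>Of two consecutive indices beyond \<open>N\<close> and \<open>n0\<close>, one has the parity prescribed by \<open>s\<close>.\<close>
  define n1 where "n1 = (if (-1) ^ Suc (N + n0 + 1) = s then N + n0 + 1 else N + n0 + 2)"
  have n1: "(-1) ^ Suc n1 = s" "N \<le> n1" "n0 \<le> n1" "0 < n1"
    using s minus_one_power_iff[of "N + n0", where 'a = int] by (auto simp: n1_def)
  have "P n1"
  proof -
    let ?e = "of_int s * (of_int p / of_int q - y)"
    have "1 / of_int (B (Suc (Suc n1))) \<le> 1 / real n1"
      using cf_den_ge[OF dig, of n1] n1(4) by (intro divide_left_mono) (auto simp: B_def)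
    also have "\<dots> \<le> ?e"
    proof -
      have "1 / ?e \<le> real n1"
        using \<open>1 / ?e \<le> real N\<close> n1(2) by linarith
      then show ?thesis
        using side n1(4) by (simp add: pos_divide_le_eq mult.commute)
    qed
    finally have "1 / of_int (B (Suc (Suc n1))) \<le> ?e" .
    moreover have "of_int s * (real_of_int (A (Suc (Suc n1))) / of_int (B (Suc (Suc n1))) - y) \<le> 1 / of_int (B (Suc (Suc n1)))"
      using sign_convergent_minus(2)[OF irr, of n1] unfolding A_def B_def n1(1)[symmetric] by simp
    ultimately have "0 \<le> of_int s * (of_int p / of_int q - real_of_int (A (Suc (Suc n1))) / of_int (B (Suc (Suc n1))))"
      by (simp add: algebra_simps)
    then have "0 \<le> real_of_int (s * (p * B (Suc (Suc n1)) - q * A (Suc (Suc n1))))"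
      unfolding cross by (rule mult_nonneg_nonneg) (use q Bpos[of n1] in simp)
    then show ?thesis
      using n1 by (simp add: P_def del: of_int_mult of_int_diff)
  qed
  define n where "n = (LEAST n. P n)"
  have Pn: "P n"
    unfolding n_def using \<open>P n1\<close> by (rule LeastI)
  show thesis
  proof (cases "n \<le> Suc n0")
    case True
    then show ?thesis
      using Pn convergent[of n] by (auto simp: P_def)
  next
    case False
    obtain l where l: "n = Suc (Suc l)" "n0 \<le> l"
      using that[of "n - 2"] False by auto
    have "\<not> P l"
      using not_less_Least[of l P] l by (simp add: n_def)
    then have u: "1 \<le> - s * (p * B n - q * A n)"
      using l Pn by (auto simp: P_def)
    \<comment> \<open>The coordinates of \<open>(p, q)\<close> in the basis of the convergents \<open>n - 1\<close> and \<open>n - 2\<close>.\<close>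
    define u v where "u = - s * (p * B n - q * A n)" and "v = s * (p * B (Suc n) - q * A (Suc n))"
    have sn: "(-1) ^ n = - s"
      using Pn by (auto simp: P_def)
    have v: "1 \<le> v"
    proof -
      have "(-1) ^ n = - real_of_int s"
        using arg_cong[OF sn, of real_of_int] by simp
      then have "0 < - of_int s * (real_of_int (A (Suc n)) / of_int (B (Suc n)) - y)"
        using sign_convergent_minus(1)[OF irr, of "Suc l"] l unfolding A_def B_def
        by (simp only:)
      then have "0 < of_int s * (of_int p / of_int q - real_of_int (A (Suc n)) / of_int (B (Suc n)))"
        using side by (simp add: algebra_simps)
      then have "0 < real_of_int (s * (p * B (Suc n) - q * A (Suc n)))"
        using cross[of "Suc l"] q Bpos[of "Suc l"] l by (simp del: of_int_mult of_int_diff)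
      then show ?thesis
        by (simp add: v_def del: of_int_mult of_int_diff)
    qed
    have "u * B (Suc n) + v * B n = - s * q * (A (Suc n) * B n - A n * B (Suc n))"
      by (simp add: u_def v_def algebra_simps)
    also have "A (Suc n) * B n - A n * B (Suc n) = - s"
      using cf_det[of ?a n] sn by (simp add: A_def B_def)
    also have "- s * q * (- s) = q"
      using s by auto
    finally have uv: "u * B (Suc n) + v * B n = q" .
    have rec: "s * (p * (c * B (Suc n) + B n) - q * (c * A (Suc n) + A n)) = c * v - u" for c
      by (simp add: u_def v_def algebra_simps)
    have step: "A (Suc (Suc n)) = ?a n * A (Suc n) + A n" "B (Suc (Suc n)) = ?a n * B (Suc n) + B n"
      by (auto simp: A_def B_def cf_num.simps(3) cf_den.simps(3))
    have "0 \<le> B n" "0 < B (Suc n)"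
      using cf_den_pos[OF dig] l by (auto simp: B_def)
    then have vB: "B n \<le> v * B n"
      using v mult_right_mono[of 1 v "B n"] by simp
    show ?thesis
    proof (cases "?a n \<le> u")
      case True
      then have "?a n * B (Suc n) \<le> u * B (Suc n)"
        using \<open>0 < B (Suc n)\<close> by (intro mult_right_mono) auto
      then have "B (Suc (Suc n)) \<le> q"
        using vB uv step by linarith
      then show ?thesis
        using Pn convergent[of n] by (auto simp: P_def)
    next
      case False
      have "u * B (Suc n) + B n \<le> q"
        using vB uv by linarith
      moreover have "0 \<le> u * v - u"
        using v u mult_left_mono[of 1 v u] by (simp add: u_def)
      moreover have "1 \<le> u"
        using u by (simp add: u_def)
      ultimately show ?thesis
        using intermediate[of "Suc l" u] False sn rec[of u] l by simp
    qed
  qed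
qed

declare cfrac_remainder.simps(2) [simp del]

text \<open>
  A point \<open>x\<close> with Brjuno value at most \<open>M + \<delta>\<close> between \<open>y\<close> and \<open>p/q\<close>, at a distance from \<open>y\<close> that
  decays in \<open>k\<close> no faster than \<open>exp (-M k)\<close> up to a power. The sign \<open>s\<close> tells the side of \<open>y\<close> on
  which \<open>p/q\<close> lies.
  
  If an intermediate fraction \<open>[a 0, \<dots>, a n, c]\<close> with \<open>c < a (n + 1)\<close> and denominator at most \<open>q\<close> is
  available, then \<open>x = [a 0, \<dots>, a n, c, 1, 1, \<dots>]\<close> does it, at a distance of order at least \<open>q^(-3)\<close> and
  without raising the Brjuno value. Otherwise take \<open>x = [a 0, \<dots>, a n, 2 a (n + 1) + 1, 1, 1, \<dots>]\<close>
  for a convergent with \<open>n \<ge> n0\<close>. Its denominator is at most \<open>q\<close> or at most the constant \<open>G\<close>, and it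
  is large enough for the additional \<open>ln 3 / q\<^sub>n\<close> to stay below \<open>\<delta>\<close>.
\<close>

lemma one_sided_approximation:
  fixes M \<delta> :: real
  assumes M: "0 < M" and \<delta>: "0 < \<delta>"
  obtains C where "0 < C"
    "\<And>y p q k s. brjuno y \<le> ereal M \<Longrightarrow> 1 \<le> q \<Longrightarrow> q \<le> int k \<Longrightarrow> s = 1 \<or> s = (-1::int) \<Longrightarrow>
       0 < of_int s * (of_int p / of_int q - y) \<Longrightarrow>
       \<exists>x. brjuno x \<le> ereal (M + \<delta>) \<and> 0 < of_int s * (of_int p / of_int q - x) \<and>
           C * exp (- M * real k) / (real k + 1) ^ 3 \<le> of_int s * (x - y)"
proof -
  \<comment> \<open>From index \<open>n0\<close> on, \<open>q\<^sub>n \<ge> n\<close> is so large that tripling a partial quotient costs at most \<open>\<delta>\<close>.\<close>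
  define n0 where "n0 = Suc (nat \<lceil>ln 3 / \<delta>\<rceil>)"
  have n0: "1 \<le> n0" "ln 3 \<le> \<delta> * real n0"
  proof -
    have "ln 3 / \<delta> \<le> real n0"
      unfolding n0_def by linarith
    then show "ln 3 \<le> \<delta> * real n0"
      using \<delta> by (simp add: field_simps)
  qed (simp add: n0_def)
  \<comment> \<open>A bound for the denominators of the convergents up to \<open>n0 + 1\<close>, which may exceed \<open>q\<close>.\<close>
  define G where "G = cf_den_bound M (Suc n0)"
  have G: "1 \<le> G"
    using cf_den_bound_mono by (simp add: G_def del: cf_den_bound.simps)
  define C where "C = exp (- M * G) / (15 * G\<^sup>2)"
  have "0 < C"
    using G by (simp add: C_def)
  have "C \<le> 1 / 15"
  proof -
    have "1 \<le> G\<^sup>2" "exp (- M * G) \<le> 1"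
      using G M by (auto simp: mult_nonneg_nonneg)
    then have "C \<le> 1 / (15 * 1)"
      unfolding C_def by (intro frac_le mult_left_mono) auto
    then show ?thesis by simp
  qed
  have "\<exists>x. brjuno x \<le> ereal (M + \<delta>) \<and> 0 < of_int s * (of_int p / of_int q - x) \<and>
           C * exp (- M * real k) / (real k + 1) ^ 3 \<le> of_int s * (x - y)"
    if y: "brjuno y \<le> ereal M" and q: "1 \<le> q" "q \<le> int k" and s: "s = 1 \<or> s = -1"
      and side: "0 < of_int s * (of_int p / of_int q - y)" for y p q k s
  proof -
    have k: "1 \<le> real k"
      using q by linarith
    have irr: "y \<notin> \<rat>"
      using y by (auto simp: brjuno_def)
    define a A B where "a = partial_quotient y" and "A = cf_num a" and "B = cf_den a"
    have dig: "cf_digits a"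
      using irr by (simp add: a_def cf_digits_partial_quotient)
    have Bpos: "1 \<le> B (Suc (Suc n))" "B (Suc n) \<le> B (Suc (Suc n))" "0 \<le> B n" for n
      using cf_den_pos[OF dig, of n] by (auto simp: B_def)
    have ss: "real_of_int s * real_of_int s = 1"
      using s by auto
    show ?thesis
    proof (cases rule: semiconvergent_between[OF irr s q(1) side, of n0, folded a_def, folded A_def B_def,
          case_names convergent intermediate])
      case (convergent n)
      define Q where "Q = real_of_int (B (Suc (Suc n)))"
      define b where "b = real_of_int (a (Suc n))"
      define x where "x = cf_val a (Suc n) (of_int (2 * a (Suc n) + 1) + 1 / golden)"
      let ?tx = "of_int (2 * a (Suc n) + 1) + 1 / golden"
      let ?ty = "cfrac_remainder y (Suc n)"
      have b: "1 \<le> b"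
        using cf_digitsD[OF dig, of "Suc n"] by (simp add: b_def)
      have Q1: "1 \<le> Q"
        using Bpos[of n] by (simp add: Q_def)
      have Qn0: "real n0 \<le> Q"
        using cf_den_ge[OF dig, of n] convergent(2) by (simp add: Q_def B_def)
      have bexp: "b \<le> exp (M * Q)"
        using partial_quotient_le_exp[OF y, of n] by (simp add: b_def Q_def a_def B_def)
      have QkG: "Q \<le> real k * G \<and> Q \<le> real k + G"
      proof -
        have "Q \<le> real k \<or> Q \<le> G"
          using convergent(4)
        proof
          assume "B (Suc (Suc n)) \<le> q"
          then show ?thesis
            using q by (simp add: Q_def)
        next
          assume "n \<le> Suc n0"
          then have "cf_den_bound M n \<le> cf_den_bound M (Suc n0)"
            by (rule lift_Suc_mono_le[of "cf_den_bound M", OF conjunct2[OF cf_den_bound_mono]])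
          then show ?thesis
            using cf_den_le_bound[OF y M, of n] by (simp add: Q_def G_def a_def B_def)
        qed
        moreover have "real k * 1 \<le> real k * G" "1 * G \<le> real k * G"
          using G k by (intro mult_left_mono mult_right_mono; simp)+
        ultimately show ?thesis
          using G k by - (intro conjI; elim disjE; linarith)
      qed
      have gold: "0 < 1 / golden" "1 / golden < 1"
        using golden_bounds by auto
      have tx: "2 * b + 1 < ?tx" "?tx < 2 * b + 2"
        using gold by (auto simp: b_def)
      have ty: "b < ?ty" "?ty < b + 1"
        using cfrac_remainder_bounds[OF irr, of "Suc n"] by (auto simp: b_def a_def)
      have txy0: "0 < ?tx" "0 < ?ty"
        using tx ty b by linarith+
      have brx: "brjuno x \<le> ereal (M + \<delta>)"
        unfolding x_def a_def
      proof (rule brjuno_golden_tail[OF y])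
        have "ln ((2 * b + 1) / b) \<le> ln 3"
          using b by (subst ln_le_cancel_iff) (auto simp: field_simps)
        also have "\<dots> \<le> \<delta> * real n0"
          by (rule n0)
        also have "\<dots> \<le> \<delta> * Q"
          using Qn0 \<delta> by (intro mult_left_mono) auto
        finally show "ln (real_of_int (2 * partial_quotient y (Suc n) + 1) / real_of_int (partial_quotient y (Suc n)))
            \<le> \<delta> * real_of_int (cf_den (partial_quotient y) (Suc (Suc n)))"
          by (simp add: b_def Q_def a_def B_def)
        show "1 \<le> 2 * partial_quotient y (Suc n) + 1"
          using b by (simp add: b_def a_def)
      qed (use \<delta> in simp)
      have sgn: "(-1) ^ Suc n = real_of_int s"
        using arg_cong[OF convergent(1), of real_of_int] by simp
      have yval: "cf_val a (Suc n) ?ty = y"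
        unfolding a_def by (rule cf_val_cfrac_remainder[OF irr])
      have D: "0 < cf_val_den a (Suc n) ?tx" "0 < cf_val_den a (Suc n) ?ty"
        using cf_val_den_pos[OF dig] txy0 by blast+
      have BQ: "real_of_int (B (Suc n)) \<le> Q" "0 \<le> real_of_int (B (Suc n))"
        using Bpos[of n] Bpos[of "Suc n"] by (auto simp: Q_def)
      \<comment> \<open>The last entries satisfy \<open>?tx \<le> 4 b\<close> and \<open>?ty \<le> 2 b\<close>, and the preceding denominator is at most \<open>b Q\<close>.\<close>
      have Dle: "cf_val_den a (Suc n) ?tx \<le> 5 * b * Q" "cf_val_den a (Suc n) ?ty \<le> 3 * b * Q"
      proof -
        have "1 * Q \<le> b * Q"
          using b Q1 by (intro mult_right_mono) auto
        then have bQ: "real_of_int (B (Suc n)) \<le> b * Q"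
          using BQ by linarith
        have "Q * ?tx + real_of_int (B (Suc n)) \<le> Q * (4 * b) + b * Q"
          using bQ tx b Q1 by (intro add_mono mult_left_mono) auto
        then show "cf_val_den a (Suc n) ?tx \<le> 5 * b * Q"
          unfolding cf_val_den_def B_def[symmetric] Q_def[symmetric] by (simp add: algebra_simps)
        have "Q * ?ty + real_of_int (B (Suc n)) \<le> Q * (2 * b) + b * Q"
          using bQ ty b Q1 by (intro add_mono mult_left_mono) auto
        then show "cf_val_den a (Suc n) ?ty \<le> 3 * b * Q"
          unfolding cf_val_den_def B_def[symmetric] Q_def[symmetric] by (simp add: algebra_simps)
      qed
      have diff: "of_int s * (x - y) = (?tx - ?ty) / (cf_val_den a (Suc n) ?tx * cf_val_den a (Suc n) ?ty)"
        using cf_val_diff[OF dig txy0, of "Suc n"] ss unfolding yval x_def[symmetric] sgn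
        by (simp add: mult.assoc[symmetric])
      have "b / ((5 * b * Q) * (3 * b * Q)) \<le> of_int s * (x - y)"
        unfolding diff using b Q1 D Dle tx ty by (intro frac_le mult_mono mult_pos_pos) auto
      moreover have "b / ((5 * b * Q) * (3 * b * Q)) = 1 / b * (1 / (15 * Q\<^sup>2))"
        using b Q1 by (simp add: field_simps power2_eq_square)
      moreover have "exp (- M * (real k + G)) * (1 / (15 * ((real k)\<^sup>2 * G\<^sup>2))) \<le> 1 / b * (1 / (15 * Q\<^sup>2))"
      proof (rule mult_mono)
        have "exp (- M * (real k + G)) \<le> exp (- M * Q)"
          using QkG M by simp
        also have "\<dots> = 1 / exp (M * Q)"
          by (simp add: exp_minus inverse_eq_divide)
        also have "\<dots> \<le> 1 / b"
          using bexp b by (intro divide_left_mono) auto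
        finally show "exp (- M * (real k + G)) \<le> 1 / b" .
        have "Q\<^sup>2 \<le> (real k * G)\<^sup>2"
          using QkG Q1 by (intro power_mono) auto
        then show "1 / (15 * ((real k)\<^sup>2 * G\<^sup>2)) \<le> 1 / (15 * Q\<^sup>2)"
          using Q1 k G by (intro divide_left_mono) (auto simp: power_mult_distrib)
      qed (use b in auto)
      moreover have "C * exp (- M * real k) / (real k + 1) ^ 3 \<le> exp (- M * (real k + G)) * (1 / (15 * ((real k)\<^sup>2 * G\<^sup>2)))"
      proof -
        have "(real k)\<^sup>2 * 1 \<le> (real k + 1)\<^sup>2 * (real k + 1)"
          by (intro mult_mono power_mono) auto
        then have "(real k)\<^sup>2 \<le> (real k + 1) ^ 3"
          by (simp add: power3_eq_cube power2_eq_square)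
        then have "C * exp (- M * real k) / (real k + 1) ^ 3 \<le> C * exp (- M * real k) / (real k)\<^sup>2"
          using \<open>0 < C\<close> k by (intro divide_left_mono mult_nonneg_nonneg mult_pos_pos) auto
        also have "\<dots> = exp (- M * (real k + G)) * (1 / (15 * ((real k)\<^sup>2 * G\<^sup>2)))"
        proof -
          have "exp (- M * (real k + G)) = exp (- M * real k) * exp (- M * G)"
            by (simp only: exp_add[symmetric] distrib_left)
          then show ?thesis
            by (simp add: C_def mult_ac)
        qed
        finally show ?thesis .
      qed
      moreover have "0 < of_int s * (of_int p / of_int q - x)"
      proof -
        have "of_int s * (real_of_int (A (Suc (Suc n))) / Q - x) = 1 / (Q * cf_val_den a (Suc n) ?tx)"
          using cf_val_minus_convergent[OF dig txy0(1), of n] ss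
          unfolding x_def[symmetric] sgn A_def[symmetric] B_def[symmetric] Q_def[symmetric]
          by simp
        then have "0 < of_int s * (real_of_int (A (Suc (Suc n))) / Q - x)"
          using D Q1 by simp
        moreover have "of_int s * (real_of_int p / real_of_int q - real_of_int (A (Suc (Suc n))) / Q)
           = real_of_int (s * (p * B (Suc (Suc n)) - q * A (Suc (Suc n)))) / (real_of_int q * Q)"
          using q Q1 by (simp add: diff_frac_eq Q_def)
        moreover have "\<dots> \<ge> 0"
          using convergent(3) q Q1 by (intro divide_nonneg_nonneg mult_nonneg_nonneg) (auto simp del: of_int_mult of_int_diff)
        ultimately show ?thesis
          by (simp add: algebra_simps)
      qed
      ultimately show ?thesis
        using brx by (intro exI[of _ x]) linarith
    next
      case (intermediate n c)
      let ?tx = "of_int c + 1 / golden"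
      let ?ty = "cfrac_remainder y (Suc n)"
      define Q where "Q = real_of_int q"
      define b where "b = real_of_int c"
      define x where "x = cf_val a (Suc n) ?tx"
      have b: "1 \<le> b"
        using intermediate by (simp add: b_def)
      have Q: "1 \<le> Q" "Q \<le> real k"
        using q by (auto simp: Q_def)
      have gold: "0 < 1 / golden" "1 / golden < 7 / 10"
        using golden_bounds by (auto simp: inverse_golden)
      have ty: "b + 1 < ?ty"
        using cfrac_remainder_bounds(1)[OF irr, of "Suc n"] intermediate(3) by (simp add: b_def a_def)
      have txy0: "0 < ?tx" "0 < ?ty"
        using b ty gold unfolding b_def by linarith+
      have brx: "brjuno x \<le> ereal (M + \<delta>)"
        unfolding x_def a_def
      proof (rule brjuno_golden_tail[OF y])
        have "ln (b / of_int (a (Suc n))) \<le> 0"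
          using b intermediate(3) by (intro ln_le_zero_iff[THEN iffD2]) (auto simp: b_def)
        also have "0 \<le> \<delta> * of_int (B (Suc (Suc n)))"
          using \<delta> Bpos[of n] by simp
        finally show "ln (real_of_int c / real_of_int (partial_quotient y (Suc n)))
            \<le> \<delta> * real_of_int (cf_den (partial_quotient y) (Suc (Suc n)))"
          by (simp add: b_def a_def B_def)
      qed (use \<delta> intermediate in simp_all)
      have sgn: "(-1) ^ Suc n = - real_of_int s"
        using arg_cong[OF intermediate(1), of real_of_int] by simp
      have yval: "cf_val a (Suc n) ?ty = y"
        unfolding a_def by (rule cf_val_cfrac_remainder[OF irr])
      have c0: "0 < real_of_int c"
        using b by (simp add: b_def)
      have D: "0 < cf_val_den a (Suc n) ?tx" "0 < cf_val_den a (Suc n) ?ty" "0 < cf_val_den a (Suc n) (of_int c)"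
        using cf_val_den_pos[OF dig] txy0 c0 by blast+
      have Dc: "cf_val_den a (Suc n) (of_int c) \<le> Q"
        using intermediate(4) unfolding cf_val_den_def B_def[symmetric] Q_def
        by (metis mult.commute of_int_add of_int_le_iff of_int_mult)
      define B1 B0 where "B1 = real_of_int (B (Suc (Suc n)))" and "B0 = real_of_int (B (Suc n))"
      have B01: "1 \<le> B1" "0 \<le> B0"
        using Bpos[of n] Bpos[of "Suc n"] by (auto simp: B1_def B0_def)
      have val_den: "cf_val_den a (Suc n) t = B1 * t + B0" for t
        by (simp add: cf_val_den_def B1_def B0_def B_def)
      have b_le: "b * B1 + B0 \<le> Q"
        using Dc by (simp add: val_den b_def mult.commute)
      have B1b: "1 * B1 \<le> b * B1" "b * 1 \<le> b * B1"
        using B01 b by (intro mult_right_mono mult_left_mono; simp)+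
      have b_le_Q: "b \<le> Q" and B1_le_Q: "B1 + B0 \<le> Q"
        using b_le B1b B01 by linarith+
      have Dle: "cf_val_den a (Suc n) ?tx \<le> 2 * Q" "cf_val_den a (Suc n) ?ty \<le> ?ty * Q"
      proof -
        have "B1 * (1 / golden) \<le> B1 * 1"
          using gold B01 by (intro mult_left_mono; linarith)
        then show "cf_val_den a (Suc n) ?tx \<le> 2 * Q"
          unfolding val_den distrib_left using b_le B1_le_Q B01 by (simp add: b_def mult.commute)
        have "B0 * 1 \<le> B0 * ?ty"
          using B01 ty b by (intro mult_left_mono) auto
        then have "B1 * ?ty + B0 \<le> ?ty * (B1 + B0)"
          by (simp add: algebra_simps)
        also have "\<dots> \<le> ?ty * Q"
          using B1_le_Q txy0 by (intro mult_left_mono) auto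
        finally show "cf_val_den a (Suc n) ?ty \<le> ?ty * Q"
          unfolding val_den .
      qed
      have diff: "of_int s * (x - y) = (?ty - ?tx) / (cf_val_den a (Suc n) ?tx * cf_val_den a (Suc n) ?ty)"
      proof -
        have "of_int s * (x - y) = - (of_int s * of_int s) * (?tx - ?ty) / (cf_val_den a (Suc n) ?tx * cf_val_den a (Suc n) ?ty)"
          using cf_val_diff[OF dig txy0, of "Suc n"] unfolding yval x_def[symmetric] sgn by simp
        then show ?thesis
          unfolding ss by (simp add: minus_divide_left)
      qed
      \<comment> \<open>Relative to \<open>?ty\<close>, which occurs in the denominator, the gap is smallest for \<open>?ty\<close> near \<open>b + 1\<close>.\<close>
      have gap: "3 / 10 * ?ty / (b + 1) \<le> ?ty - ?tx"
      proof -
        have "3 / 10 * ?ty / (b + 1) = 3 / 10 + 3 / 10 * (?ty - (b + 1)) / (b + 1)"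
          using b by (simp add: field_simps)
        also have "3 / 10 * (?ty - (b + 1)) / (b + 1) \<le> (?ty - (b + 1)) / 1"
          using b ty by (intro frac_le) auto
        finally show ?thesis
          using gold by (simp add: b_def)
      qed
      have "3 / 10 * ?ty / (b + 1) / (2 * Q * (?ty * Q)) \<le> of_int s * (x - y)"
        unfolding diff
      proof (rule frac_le)
        show "0 \<le> ?ty - ?tx"
          using ty gold by (simp add: b_def)
        show "cf_val_den a (Suc n) ?tx * cf_val_den a (Suc n) ?ty \<le> 2 * Q * (?ty * Q)"
          using Dle D Q by (intro mult_mono) auto
      qed (use gap D in auto)
      moreover have "3 / 10 * ?ty / (b + 1) / (2 * Q * (?ty * Q)) = 3 / 20 / ((b + 1) * Q * Q)"
      proof -
        have "3 / 10 * ?ty / (b + 1) / (2 * Q * (?ty * Q)) = (?ty * 3) / (?ty * (20 * ((b + 1) * Q * Q)))"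
          by (simp add: mult_ac)
        then show ?thesis
          using txy0 by simp
      qed
      moreover have "3 / 20 / (real k + 1) ^ 3 \<le> 3 / 20 / ((b + 1) * Q * Q)"
      proof (rule divide_left_mono)
        have "(b + 1) * Q * Q \<le> (real k + 1) * (real k + 1) * (real k + 1)"
          using b b_le_Q Q by (intro mult_mono) auto
        then show "(b + 1) * Q * Q \<le> (real k + 1) ^ 3"
          by (simp add: power3_eq_cube)
      qed (use b Q in auto)
      moreover have "C * exp (- M * real k) / (real k + 1) ^ 3 \<le> 3 / 20 / (real k + 1) ^ 3"
      proof (rule divide_right_mono)
        have "C * exp (- M * real k) \<le> 1 / 15 * 1"
          using \<open>C \<le> 1 / 15\<close> \<open>0 < C\<close> M by (intro mult_mono) auto
        then show "C * exp (- M * real k) \<le> 3 / 20"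
          by simp
      qed simp
      moreover have "0 < of_int s * (of_int p / of_int q - x)"
      proof -
        have "cf_val a (Suc n) (of_int c) - x = of_int s * ((1 / golden) / (cf_val_den a (Suc n) (of_int c) * cf_val_den a (Suc n) ?tx))"
          using cf_val_diff[OF dig c0 txy0(1), of "Suc n"] unfolding x_def[symmetric] sgn by simp
        then have "of_int s * (cf_val a (Suc n) (of_int c) - x) = (1 / golden) / (cf_val_den a (Suc n) (of_int c) * cf_val_den a (Suc n) ?tx)"
          using ss by (simp only: mult.assoc[symmetric] mult_1_left)
        then have "0 < of_int s * (cf_val a (Suc n) (of_int c) - x)"
          using gold D by simp
        moreover have "of_int s * (real_of_int p / real_of_int q - cf_val a (Suc n) (of_int c)) =
            real_of_int (s * (p * (c * B (Suc (Suc n)) + B (Suc n)) - q * (c * A (Suc (Suc n)) + A (Suc n)))) /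
            (real_of_int q * cf_val_den a (Suc n) (of_int c))"
        proof -
          have "real_of_int q \<noteq> 0" "cf_val_den a (Suc n) (of_int c) \<noteq> 0"
            using q D by auto
          then show ?thesis
            unfolding cf_val_def by (subst diff_frac_eq)
              (simp_all add: cf_val_den_def B_def A_def mult.commute)
        qed
        moreover have "\<dots> \<ge> 0"
          using intermediate(5) q D by (intro divide_nonneg_nonneg mult_nonneg_nonneg) (auto simp del: of_int_mult of_int_diff)
        ultimately show ?thesis
          by (simp add: algebra_simps)
      qed
      ultimately show ?thesis
        using brx by (intro exI[of _ x]) linarith
    qed
  qed
  with \<open>0 < C\<close> show thesis
    by (rule that)
qed

section \<open>Continuously differentiable families of power series\<close>

lemma H_inf_power_series:
  assumes r: "0 < r" and sm: "summable (\<lambda>k. cmod (fps_nth F k) * r ^ k)"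
  shows "F \<in> H_inf r" and "0 \<le> H_inf_norm r F"
    and "H_inf_norm r F \<le> (\<Sum>k. cmod (fps_nth F k) * r ^ k)"
proof -
  have le: "cmod (eval_fps F z) \<le> (\<Sum>k. cmod (fps_nth F k) * r ^ k)" if "z \<in> ball 0 r" for z
    unfolding eval_fps_def
  proof (rule norm_suminf_le[OF _ sm])
    fix k
    have "cmod z ^ k \<le> r ^ k"
      using that by (intro power_mono) auto
    then show "cmod (fps_nth F k * z ^ k) \<le> cmod (fps_nth F k) * r ^ k"
      by (simp add: norm_mult norm_power mult_left_mono)
  qed
  have "summable (\<lambda>k. fps_nth F k * of_real r ^ k)"
    by (rule summable_norm_cancel) (use sm r in \<open>simp add: norm_mult norm_power\<close>)
  then have "ereal r \<le> fps_conv_radius F"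
    using conv_radius_geI[of "fps_nth F" "of_real r"] r by (simp add: fps_conv_radius_def)
  moreover have "bounded (eval_fps F ` ball 0 r)"
    using le unfolding bounded_iff by (intro exI[of _ "\<Sum>k. cmod (fps_nth F k) * r ^ k"]) auto
  ultimately show "F \<in> H_inf r"
    using H_inf_iff[OF r] by blast
  show "H_inf_norm r F \<le> (\<Sum>k. cmod (fps_nth F k) * r ^ k)"
    unfolding H_inf_norm_def using le r by (intro cSUP_least) auto
  have "0 \<le> cmod (eval_fps F 0)"
    by simp
  also have "\<dots> \<le> H_inf_norm r F"
    unfolding H_inf_norm_def using le r by (intro cSUP_upper bdd_aboveI2) auto
  finally show "0 \<le> H_inf_norm r F" .
qed

text \<open>
  Tannery's theorem for null limits, along an arbitrary filter.
\<close>

lemma suminf_dominated_tendsto_0: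
  fixes a :: "nat \<Rightarrow> 'b \<Rightarrow> real"
  assumes lim: "\<And>k. (a k \<longlongrightarrow> 0) F"
    and bound: "\<forall>\<^sub>F x in F. \<forall>k. norm (a k x) \<le> B k" and "summable B"
  shows "((\<lambda>x. \<Sum>k. a k x) \<longlongrightarrow> 0) F"
proof (cases "F = bot")
  case False
  have "\<forall>\<^sub>F (k, x) in at_top \<times>\<^sub>F F. norm (a k x) \<le> B k"
    unfolding eventually_prod_filter
    using bound by (intro exI[of _ "\<lambda>_. True"] exI[of _ "\<lambda>x. \<forall>k. norm (a k x) \<le> B k"]) auto
  from tannerys_theorem[OF lim this \<open>summable B\<close> False] show ?thesis
    by simp
qed auto

lemma norm_deriv_le:
  assumes "f holomorphic_on ball z R" "\<And>w. w \<in> ball z R \<Longrightarrow> cmod (f w) \<le> m" "0 < R"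
  shows "cmod (deriv f z) \<le> 2 * m / R"
proof -
  have "cmod ((deriv ^^ 1) f z) \<le> fact 1 * m / (R / 2) ^ 1"
  proof (rule Cauchy_inequality)
    show "f holomorphic_on ball z (R / 2)"
      using assms by (auto intro: holomorphic_on_subset)
    have "cball z (R / 2) \<subseteq> ball z R"
      using assms by auto
    then show "continuous_on (cball z (R / 2)) f"
      using assms holomorphic_on_imp_continuous_on continuous_on_subset by blast
    show "cmod (f x) \<le> m" if "cmod (z - x) = R / 2" for x
      using that assms by (intro assms) (auto simp: dist_norm)
  qed (use assms in auto)
  then show ?thesis
    by (simp add: mult.commute)
qed

text \<open>
  If \<open>z'\<close> is closer than \<open>R/2\<close>, the derivative is bounded on the segment by Cauchy's estimate. If it
  is farther away, the factor \<open>\<bar>z' - z\<bar> / R\<close> is bounded below and the trivial bound \<open>2 m\<close> for the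
  increment suffices. In this second case \<open>z'\<close> may lie outside the disk, so no path between the
  points is required.
\<close>

lemma whitney_remainder_le:
  assumes hol: "f holomorphic_on ball z R" and bd: "\<And>w. w \<in> ball z R \<Longrightarrow> cmod (f w) \<le> m"
    and R: "0 < R" and m: "cmod (f z') \<le> m"
  shows "cmod (f z' - f z - deriv f z * (z' - z)) \<le> 6 * m / R * cmod (z' - z)"
proof -
  have m0: "0 \<le> m"
    using m norm_ge_zero order_trans by blast
  have d: "cmod (deriv f z * (z' - z)) \<le> 2 * m / R * cmod (z' - z)"
    unfolding norm_mult using norm_deriv_le[OF hol bd R] by (intro mult_right_mono) auto
  have "cmod (f z' - f z) \<le> 4 * m / R * cmod (z' - z)"
  proof (cases "cmod (z' - z) < R / 2")
    case True
    have "cmod (f z' - f z) \<le> (2 * m / (R / 2)) * cmod (z' - z)"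
    proof (rule field_differentiable_bound[of "ball z (R / 2)"])
      show "(f has_field_derivative deriv f w) (at w within ball z (R / 2))" if "w \<in> ball z (R / 2)" for w
        using that hol R by (intro holomorphic_derivI[of f "ball z R", THEN has_field_derivative_at_within]) auto
      show "cmod (deriv f w) \<le> 2 * m / (R / 2)" if "w \<in> ball z (R / 2)" for w
      proof (rule norm_deriv_le)
        have sub: "ball w (R / 2) \<subseteq> ball z R"
          using that by (auto simp: ball_subset_ball_iff dist_commute)
        then show "f holomorphic_on ball w (R / 2)"
          using hol holomorphic_on_subset by blast
        show "\<And>u. u \<in> ball w (R / 2) \<Longrightarrow> cmod (f u) \<le> m"
          using sub bd by blast
      qed (use R in auto)
    qed (use True R in \<open>auto simp: dist_norm norm_minus_commute\<close>)
    then show ?thesis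
      by simp
  next
    case False
    have "cmod (f z' - f z) \<le> m + m"
      using norm_triangle_ineq4[of "f z'" "f z"] m bd[of z] R by auto
    also have "\<dots> = 4 * m / R * (R / 2)"
      using R by simp
    also have "\<dots> \<le> 4 * m / R * cmod (z' - z)"
      using False m0 R by (intro mult_left_mono) auto
    finally show ?thesis .
  qed
  then have "cmod (f z' - f z - deriv f z * (z' - z)) \<le> 4 * m / R * cmod (z' - z) + 2 * m / R * cmod (z' - z)"
    using d norm_triangle_ineq4[of "f z' - f z" "deriv f z * (z' - z)"] by linarith
  then show ?thesis
    by (simp add: algebra_simps)
qed

text \<open>
  The mean value inequality for \<open>f w - f' a w\<close> on a disk where \<open>f'\<close> varies little.
\<close>

lemma holomorphic_strictly_differentiable:
  assumes hol: "f holomorphic_on ball z0 R" and R: "0 < R"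
  shows "((\<lambda>(a, b). cmod (f b - f a - deriv f a * (b - a)) / cmod (b - a)) \<longlongrightarrow> 0) (nhds z0 \<times>\<^sub>F nhds z0)"
proof (rule tendstoI)
  fix e :: real
  assume "0 < e"
  have "continuous_on (ball z0 R) (deriv f)"
    using hol by (intro holomorphic_on_imp_continuous_on holomorphic_deriv) auto
  then have "isCont (deriv f) z0"
    using R by (simp add: continuous_on_eq_continuous_at)
  then have "\<forall>\<^sub>F w in nhds z0. dist (deriv f w) (deriv f z0) < e / 4"
    using \<open>0 < e\<close> by (intro tendstoD) (auto simp: isCont_def tendsto_nhds_iff)
  then obtain d where d: "0 < d" "\<And>w. dist w z0 < d \<Longrightarrow> dist (deriv f w) (deriv f z0) < e / 4"
    by (auto simp: eventually_nhds_metric)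
  define \<eta> where "\<eta> = min d R"
  have \<eta>: "0 < \<eta>" "\<eta> \<le> d" "\<eta> \<le> R"
    using d R by (auto simp: \<eta>_def)
  have *: "cmod (f b - f a - deriv f a * (b - a)) \<le> e / 2 * cmod (b - a)"
    if a: "dist a z0 < \<eta>" and b: "dist b z0 < \<eta>" for a b
  proof -
    have "cmod ((\<lambda>w. f w - deriv f a * w) b - (\<lambda>w. f w - deriv f a * w) a) \<le> e / 2 * cmod (b - a)"
    proof (rule field_differentiable_bound[of "ball z0 \<eta>" _ "\<lambda>w. deriv f w - deriv f a"])
      show "((\<lambda>w. f w - deriv f a * w) has_field_derivative deriv f w - deriv f a) (at w within ball z0 \<eta>)"
        if "w \<in> ball z0 \<eta>" for w
      proof -
        have "(f has_field_derivative deriv f w) (at w)"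
          using that \<eta> hol by (intro holomorphic_derivI[of f "ball z0 R"]) auto
        then show ?thesis
          by (rule DERIV_diff[OF _ DERIV_cmult_Id, THEN has_field_derivative_at_within])
      qed
      show "cmod (deriv f w - deriv f a) \<le> e / 2" if "w \<in> ball z0 \<eta>" for w
      proof -
        have "dist (deriv f w) (deriv f z0) < e / 4" "dist (deriv f a) (deriv f z0) < e / 4"
          using that a \<eta> d(2) by (auto simp: dist_commute)
        then have "dist (deriv f w) (deriv f a) < e / 2"
          using dist_triangle2[of "deriv f w" "deriv f a" "deriv f z0"] by linarith
        then show ?thesis
          by (simp add: dist_norm)
      qed
    qed (use a b in \<open>auto simp: dist_commute\<close>)
    then show ?thesis
      by (simp add: algebra_simps)
  qed
  have "dist (cmod (f b - f a - deriv f a * (b - a)) / cmod (b - a)) 0 < e"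
    if "dist a z0 < \<eta>" "dist b z0 < \<eta>" for a b
  proof (cases "a = b")
    case False
    have "cmod (f b - f a - deriv f a * (b - a)) \<le> e / 2 * cmod (b - a)"
      using * that by blast
    also have "\<dots> < e * cmod (b - a)"
      using False \<open>0 < e\<close> by (intro mult_strict_right_mono) auto
    finally show ?thesis
      using False by (simp add: divide_less_eq)
  qed (use \<open>0 < e\<close> in auto)
  then show "\<forall>\<^sub>F x in nhds z0 \<times>\<^sub>F nhds z0.
      dist (case x of (a, b) \<Rightarrow> cmod (f b - f a - deriv f a * (b - a)) / cmod (b - a)) 0 < e"
    unfolding eventually_prod_filter
    using \<eta>(1) by (intro exI[of _ "\<lambda>w. dist w z0 < \<eta>"]) (auto simp: eventually_nhds_metric)
qed

text \<open>
  The norm of a power series on the disk of radius \<open>r\<close> is at most \<open>\<Sum>k. \<bar>F\<^sub>k\<bar> r^k\<close>. Continuity of the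
  family, continuity of its derivative and the Whitney condition thus reduce to the convergence to
  zero of three series, whose terms converge to zero because every coefficient is holomorphic near
  \<open>lam0\<close> and are dominated by \<open>m\<^sub>k / \<rho>\<^sub>k r^k\<close> by Cauchy's estimate. The disks on which the
  coefficients are controlled may shrink with \<open>k\<close> and may leave \<open>S\<close>.
\<close>

lemma C1_hol_power_series:
  fixes S :: "complex set" and g :: "nat \<Rightarrow> complex \<Rightarrow> complex" and F :: "complex \<Rightarrow> complex fps"
  assumes r: "0 < r" and coeff: "\<And>lam k. lam \<in> S \<Longrightarrow> fps_nth (F lam) k = g k lam"
    and local: "\<And>lam0. lam0 \<in> S \<Longrightarrow> \<exists>\<delta>>0. \<exists>m \<rho>. (\<forall>k. 0 < \<rho> k \<and> \<rho> k \<le> 1) \<and>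
       summable (\<lambda>k. m k / \<rho> k * r ^ k) \<and>
       (\<forall>lam\<in>S. dist lam lam0 < \<delta> \<longrightarrow>
          (\<forall>k. g k holomorphic_on ball lam (\<rho> k) \<and> (\<forall>z\<in>ball lam (\<rho> k). cmod (g k z) \<le> m k)))"
  shows "F \<in> C1_hol (H_inf r) (\<lambda>c F. fps_const c * F) (H_inf_norm r) S"
proof -
  let ?N = "H_inf_norm r"
  define F1 where "F1 lam = Abs_fps (\<lambda>k. deriv (g k) lam)" for lam
  have key: "\<exists>\<delta>>0. \<exists>m \<rho>. (\<forall>k. 0 < \<rho> k \<and> 0 \<le> m k \<and> m k \<le> m k / \<rho> k) \<and>
       summable (\<lambda>k. m k / \<rho> k * r ^ k) \<and>
       (\<forall>lam\<in>S. dist lam lam0 < \<delta> \<longrightarrow>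
          (\<forall>k. g k holomorphic_on ball lam (\<rho> k) \<and> (\<forall>z\<in>ball lam (\<rho> k). cmod (g k z) \<le> m k)))"
    if lam0: "lam0 \<in> S" for lam0
  proof -
    obtain \<delta> m \<rho> where 1: "0 < \<delta>" "\<forall>k. 0 < \<rho> k \<and> \<rho> k \<le> 1" "summable (\<lambda>k. m k / \<rho> k * r ^ k)"
      "\<forall>lam\<in>S. dist lam lam0 < \<delta> \<longrightarrow>
          (\<forall>k. g k holomorphic_on ball lam (\<rho> k) \<and> (\<forall>z\<in>ball lam (\<rho> k). cmod (g k z) \<le> m k))"
      using local[OF lam0] by blast
    have m0: "0 \<le> m k" for k
    proof -
      have "lam0 \<in> ball lam0 (\<rho> k)"
        using 1(2) by simp
      then have "cmod (g k lam0) \<le> m k"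
        using 1(1,4) lam0 by auto
      then show ?thesis
        using norm_ge_zero order_trans by blast
    qed
    then have "m k \<le> m k / \<rho> k" for k
      using 1(2) mult_left_mono[of "\<rho> k" 1 "m k"] by (simp add: pos_le_divide_eq)
    then show ?thesis
      using 1 m0 by blast
  qed
  have bound: "\<exists>\<delta>>0. \<exists>c. summable (\<lambda>k. c k * r ^ k) \<and> (\<forall>a\<in>S. dist a lam0 < \<delta> \<longrightarrow>
     (\<forall>k. cmod (g k a) \<le> c k \<and> cmod (deriv (g k) a) \<le> 2 * c k \<and>
       (\<forall>b\<in>S. dist b lam0 < \<delta> \<longrightarrow> cmod (g k b - g k a - deriv (g k) a * (b - a)) \<le> 6 * c k * cmod (b - a))))
     \<and> (\<forall>k. \<exists>R>0. g k holomorphic_on ball lam0 R) \<and> (\<forall>k. 0 \<le> c k)"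
    if lam0: "lam0 \<in> S" for lam0
  proof -
    obtain \<delta> m \<rho> where 0: "\<forall>k. 0 < \<rho> k \<and> 0 \<le> m k \<and> m k \<le> m k / \<rho> k"
        "\<forall>lam\<in>S. dist lam lam0 < \<delta> \<longrightarrow>
          (\<forall>k. g k holomorphic_on ball lam (\<rho> k) \<and> (\<forall>z\<in>ball lam (\<rho> k). cmod (g k z) \<le> m k))"
      and 1: "0 < \<delta>" "summable (\<lambda>k. m k / \<rho> k * r ^ k)"
      using key[OF lam0] by blast
    have \<rho>: "\<And>k. 0 < \<rho> k" and m: "\<And>k. 0 \<le> m k" "\<And>k. m k \<le> m k / \<rho> k"
      and 2: "\<And>lam k. lam \<in> S \<Longrightarrow> dist lam lam0 < \<delta> \<Longrightarrow> g k holomorphic_on ball lam (\<rho> k)"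
      and 3: "\<And>lam k z. lam \<in> S \<Longrightarrow> dist lam lam0 < \<delta> \<Longrightarrow> z \<in> ball lam (\<rho> k) \<Longrightarrow> cmod (g k z) \<le> m k"
      using 0 by blast+
    have 4: "cmod (g k a) \<le> m k" if "a \<in> S" "dist a lam0 < \<delta>" for a k
      using 3[OF that, of a k] \<rho>[of k] by simp
    show ?thesis
    proof (rule exI[of _ \<delta>], intro conjI exI[of _ "\<lambda>k. m k / \<rho> k"] ballI allI impI)
      fix a k assume a: "a \<in> S" "dist a lam0 < \<delta>"
      show "cmod (g k a) \<le> m k / \<rho> k"
        using 4[OF a, of k] m(2)[of k] by linarith
      show "cmod (deriv (g k) a) \<le> 2 * (m k / \<rho> k)"
        using norm_deriv_le[OF 2[OF a] 3[OF a] \<rho>] by simp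
      show "cmod (g k b - g k a - deriv (g k) a * (b - a)) \<le> 6 * (m k / \<rho> k) * cmod (b - a)"
        if b: "b \<in> S" "dist b lam0 < \<delta>" for b
        using whitney_remainder_le[OF 2[OF a] 3[OF a] \<rho> 4[OF b]] by simp
    next
      fix k
      show "\<exists>R>0. g k holomorphic_on ball lam0 R"
        using 2[OF lam0, of k] 1(1) \<rho>[of k] by auto
      show "0 \<le> m k / \<rho> k"
        using \<rho>[of k] m(1)[of k] by simp
    qed (use 1 in auto)
  qed
  have nth: "fps_nth (F b - F a - fps_const (b - a) * F1 a) k = g k b - g k a - deriv (g k) a * (b - a)"
    if "a \<in> S" "b \<in> S" for a b k
    using that by (simp add: coeff F1_def mult.commute)
  have whitney: "\<exists>\<delta>>0. \<forall>a\<in>S. \<forall>b\<in>S. dist a lam0 < \<delta> \<longrightarrow> dist b lam0 < \<delta> \<longrightarrow>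
      ?N (F b - F a - fps_const (b - a) * F1 a) \<le> \<epsilon> * dist a b"
    if lam0: "lam0 \<in> S" and "0 < \<epsilon>" for lam0 \<epsilon>
  proof -
    obtain \<delta> c where 0: "\<forall>a\<in>S. dist a lam0 < \<delta> \<longrightarrow> (\<forall>k. cmod (g k a) \<le> c k \<and> cmod (deriv (g k) a) \<le> 2 * c k \<and>
       (\<forall>b\<in>S. dist b lam0 < \<delta> \<longrightarrow> cmod (g k b - g k a - deriv (g k) a * (b - a)) \<le> 6 * c k * cmod (b - a)))"
      and 1: "0 < \<delta>" "summable (\<lambda>k. c k * r ^ k)" "\<forall>k. \<exists>R>0. g k holomorphic_on ball lam0 R"
      "\<forall>k. 0 \<le> c k"
      using bound[OF lam0] by blast
    have 2: "cmod (g k b - g k a - deriv (g k) a * (b - a)) \<le> 6 * c k * cmod (b - a)"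
      if "a \<in> S" "b \<in> S" "dist a lam0 < \<delta>" "dist b lam0 < \<delta>" for a b k
      using 0 that by blast
    let ?R = "\<lambda>k (a, b). cmod (g k b - g k a - deriv (g k) a * (b - a)) / cmod (b - a) * r ^ k"
    \<comment> \<open>The filter of pairs in \<open>S\<close> converging to the diagonal point \<open>(lam0, lam0)\<close>.\<close>
    let ?\<Phi> = "inf (nhds lam0 \<times>\<^sub>F nhds lam0) (principal (S \<times> S))"
    have quot: "cmod (g k b - g k a - deriv (g k) a * (b - a)) / cmod (b - a) \<le> 6 * c k"
      if "a \<in> S" "b \<in> S" "dist a lam0 < \<delta>" "dist b lam0 < \<delta>" for a b k
      using 2[OF that, of k] 1(4) by (cases "a = b") (auto simp: divide_le_eq)
    have sm: "summable (\<lambda>k. 6 * c k * r ^ k)"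
      using summable_mult[OF 1(2), of 6] by (simp add: mult.assoc)
    have "((\<lambda>x. \<Sum>k. ?R k x) \<longlongrightarrow> 0) ?\<Phi>"
    proof (rule suminf_dominated_tendsto_0[OF _ _ sm])
      fix k
      obtain R where "0 < R" "g k holomorphic_on ball lam0 R"
        using 1(3) by blast
      then have "((\<lambda>x. (case x of (a, b) \<Rightarrow> cmod (g k b - g k a - deriv (g k) a * (b - a)) / cmod (b - a)) * r ^ k) \<longlongrightarrow> 0 * r ^ k)
          (nhds lam0 \<times>\<^sub>F nhds lam0)"
        by (intro tendsto_mult holomorphic_strictly_differentiable tendsto_const)
      then show "(?R k \<longlongrightarrow> 0) ?\<Phi>"
        by (intro filterlim_mono[OF _ order_refl inf_le1]) (auto simp: case_prod_unfold)
    next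
      have "norm (?R k (a, b)) \<le> 6 * c k * r ^ k"
        if "a \<in> S" "b \<in> S" "dist a lam0 < \<delta>" "dist b lam0 < \<delta>" for a b k
        using mult_right_mono[OF quot[OF that, of k], of "r ^ k"] r by (simp add: abs_mult)
      then have "\<forall>\<^sub>F x in nhds lam0 \<times>\<^sub>F nhds lam0. x \<in> S \<times> S \<longrightarrow> (\<forall>k. norm (?R k x) \<le> 6 * c k * r ^ k)"
        unfolding eventually_prod_filter
        using 1(1) by (intro exI[of _ "\<lambda>w. dist w lam0 < \<delta>"]) (auto simp: eventually_nhds_metric)
      then show "\<forall>\<^sub>F x in ?\<Phi>. \<forall>k. norm (?R k x) \<le> 6 * c k * r ^ k"
        by (simp add: eventually_inf_principal)
    qed
    then have "\<forall>\<^sub>F x in nhds lam0 \<times>\<^sub>F nhds lam0. x \<in> S \<times> S \<longrightarrow> (\<Sum>k. ?R k x) < \<epsilon>"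
      using order_tendstoD(2) \<open>0 < \<epsilon>\<close> by (fastforce simp: eventually_inf_principal)
    then obtain P Q where PQ: "eventually P (nhds lam0)" "eventually Q (nhds lam0)"
      "\<And>a b. P a \<Longrightarrow> Q b \<Longrightarrow> (a, b) \<in> S \<times> S \<Longrightarrow> (\<Sum>k. ?R k (a, b)) < \<epsilon>"
      unfolding eventually_prod_filter by blast
    then obtain d1 d2 where d: "0 < d1" "0 < d2" "\<And>w. dist w lam0 < d1 \<Longrightarrow> P w" "\<And>w. dist w lam0 < d2 \<Longrightarrow> Q w"
      unfolding eventually_nhds_metric by blast
    have "?N (F b - F a - fps_const (b - a) * F1 a) \<le> \<epsilon> * dist a b"
      if ab: "a \<in> S" "b \<in> S" "dist a lam0 < min \<delta> (min d1 d2)" "dist b lam0 < min \<delta> (min d1 d2)" for a b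
    proof -
      let ?q = "\<lambda>k. cmod (g k b - g k a - deriv (g k) a * (b - a)) / cmod (b - a) * r ^ k"
      have eq: "cmod (fps_nth (F b - F a - fps_const (b - a) * F1 a) k) * r ^ k = cmod (b - a) * ?q k" for k
        unfolding nth[OF ab(1,2)] by (cases "a = b") auto
      have smq: "summable ?q"
      proof (rule summable_comparison_test'[OF sm])
        show "norm (?q k) \<le> 6 * c k * r ^ k" for k
          using mult_right_mono[OF quot[of a b k], of "r ^ k"] ab r by (simp add: abs_mult)
      qed
      have "?N (F b - F a - fps_const (b - a) * F1 a) \<le> (\<Sum>k. cmod (b - a) * ?q k)"
        using H_inf_power_series(3)[OF r, of "F b - F a - fps_const (b - a) * F1 a", unfolded eq,
            OF summable_mult[OF smq]] .
      also have "\<dots> = cmod (b - a) * (\<Sum>k. ?q k)"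
        using smq by (rule suminf_mult)
      also have "\<dots> \<le> cmod (b - a) * \<epsilon>"
        using PQ(3)[of a b] d ab by (intro mult_left_mono) auto
      finally show ?thesis
        by (simp add: dist_norm norm_minus_commute mult.commute)
    qed
    then show ?thesis
      using 1(1) d by (intro exI[of _ "min \<delta> (min d1 d2)"]) auto
  qed
  have cont: "((\<lambda>\<mu>. ?N (G \<mu> - G lam0)) \<longlongrightarrow> 0) (at lam0 within S)"
    if lam0: "lam0 \<in> S" and G: "\<And>lam k. lam \<in> S \<Longrightarrow> fps_nth (G lam) k = h k lam"
      and bd: "0 < \<delta>" "\<And>a k. a \<in> S \<Longrightarrow> dist a lam0 < \<delta> \<Longrightarrow> cmod (h k a) \<le> c k" "summable (\<lambda>k. c k * r ^ k)"
      and cont: "\<And>k. isCont (h k) lam0"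
    for G :: "complex \<Rightarrow> complex fps" and h :: "nat \<Rightarrow> complex \<Rightarrow> complex" and c \<delta> lam0
  proof -
    let ?T = "\<lambda>k \<mu>. cmod (h k \<mu> - h k lam0) * r ^ k"
    have ev: "\<forall>\<^sub>F \<mu> in at lam0 within S. \<mu> \<in> S \<and> dist \<mu> lam0 < \<delta>"
      using bd(1) by (auto simp: eventually_at)
    have T: "norm (?T k \<mu>) \<le> 2 * c k * r ^ k" if "\<mu> \<in> S \<and> dist \<mu> lam0 < \<delta>" for \<mu> k
    proof -
      have "cmod (h k \<mu> - h k lam0) \<le> 2 * c k"
        using bd(2)[of \<mu> k] bd(2)[of lam0 k] that lam0 bd(1) norm_triangle_ineq4[of "h k \<mu>" "h k lam0"] by auto
      then show ?thesis
        using r by (simp add: abs_mult mult_right_mono)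
    qed
    have sm: "summable (\<lambda>k. 2 * c k * r ^ k)"
      using summable_mult[OF bd(3), of 2] by (simp add: mult.assoc)
    have sum0: "((\<lambda>\<mu>. \<Sum>k. ?T k \<mu>) \<longlongrightarrow> 0) (at lam0 within S)"
    proof (rule suminf_dominated_tendsto_0[OF _ _ sm])
      fix k
      have "(h k \<longlongrightarrow> h k lam0) (at lam0 within S)"
        using cont[of k] continuous_at_imp_continuous_at_within continuous_within by blast
      then show "(?T k \<longlongrightarrow> 0) (at lam0 within S)"
        by (intro tendsto_mult_left_zero tendsto_norm_zero) (simp add: LIM_zero)
    next
      show "\<forall>\<^sub>F \<mu> in at lam0 within S. \<forall>k. norm (?T k \<mu>) \<le> 2 * c k * r ^ k"
        using ev by eventually_elim (use T in blast)
    qed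
    have N: "0 \<le> ?N (G \<mu> - G lam0) \<and> ?N (G \<mu> - G lam0) \<le> (\<Sum>k. ?T k \<mu>)"
      if \<mu>: "\<mu> \<in> S \<and> dist \<mu> lam0 < \<delta>" for \<mu>
    proof -
      have "summable (\<lambda>k. ?T k \<mu>)"
        by (rule summable_comparison_test'[OF sm]) (rule T[OF \<mu>])
      then have "summable (\<lambda>k. cmod (fps_nth (G \<mu> - G lam0) k) * r ^ k)"
        using \<mu> lam0 by (simp add: G)
      from H_inf_power_series(2,3)[OF r this] show ?thesis
        using \<mu> lam0 by (simp add: G)
    qed
    show ?thesis
    proof (rule tendsto_sandwich[OF _ _ tendsto_const sum0])
      show "\<forall>\<^sub>F \<mu> in at lam0 within S. 0 \<le> ?N (G \<mu> - G lam0)"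
        using ev by eventually_elim (use N in blast)
      show "\<forall>\<^sub>F \<mu> in at lam0 within S. ?N (G \<mu> - G lam0) \<le> (\<Sum>k. ?T k \<mu>)"
        using ev by eventually_elim (use N in blast)
    qed
  qed
  have member: "F lam \<in> H_inf r \<and> F1 lam \<in> H_inf r \<and>
      ((\<lambda>\<mu>. ?N (F \<mu> - F lam)) \<longlongrightarrow> 0) (at lam within S) \<and>
      ((\<lambda>\<mu>. ?N (F1 \<mu> - F1 lam)) \<longlongrightarrow> 0) (at lam within S)" if lam: "lam \<in> S" for lam
  proof -
    obtain \<delta> c where 0: "\<forall>a\<in>S. dist a lam < \<delta> \<longrightarrow> (\<forall>k. cmod (g k a) \<le> c k \<and> cmod (deriv (g k) a) \<le> 2 * c k \<and>
       (\<forall>b\<in>S. dist b lam < \<delta> \<longrightarrow> cmod (g k b - g k a - deriv (g k) a * (b - a)) \<le> 6 * c k * cmod (b - a)))"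
      and 1: "0 < \<delta>" "summable (\<lambda>k. c k * r ^ k)" "\<forall>k. \<exists>R>0. g k holomorphic_on ball lam R"
      using bound[OF lam] by blast
    have 2: "\<And>a k. a \<in> S \<Longrightarrow> dist a lam < \<delta> \<Longrightarrow> cmod (g k a) \<le> c k"
        "\<And>a k. a \<in> S \<Longrightarrow> dist a lam < \<delta> \<Longrightarrow> cmod (deriv (g k) a) \<le> 2 * c k"
      using 0 by blast+
    have sm2: "summable (\<lambda>k. 2 * c k * r ^ k)"
      using summable_mult[OF 1(2), of 2] by (simp add: mult.assoc)
    have isc: "isCont (g k) lam \<and> isCont (deriv (g k)) lam" for k
    proof -
      obtain R where R: "0 < R" "g k holomorphic_on ball lam R"
        using 1(3) by blast
      then have "continuous_on (ball lam R) (g k)" "continuous_on (ball lam R) (deriv (g k))"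
        by (auto intro!: holomorphic_on_imp_continuous_on holomorphic_deriv)
      then show ?thesis
        using R(1) by (simp add: continuous_on_eq_continuous_at)
    qed
    have "summable (\<lambda>k. cmod (fps_nth (F lam) k) * r ^ k)"
      using 2(1)[OF lam] 1(1) r coeff[OF lam]
      by (intro summable_comparison_test'[OF 1(2)]) (auto simp: abs_mult intro!: mult_right_mono)
    moreover have "summable (\<lambda>k. cmod (fps_nth (F1 lam) k) * r ^ k)"
      using 2(2)[OF lam] 1(1) r
      by (intro summable_comparison_test'[OF sm2]) (auto simp: F1_def abs_mult intro!: mult_right_mono)
    moreover have "((\<lambda>\<mu>. ?N (F \<mu> - F lam)) \<longlongrightarrow> 0) (at lam within S)"
      using isc by (intro cont[OF lam coeff 1(1) 2(1) 1(2)]) auto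
    moreover have "((\<lambda>\<mu>. ?N (F1 \<mu> - F1 lam)) \<longlongrightarrow> 0) (at lam within S)"
      using isc by (intro cont[OF lam _ 1(1) 2(2) sm2]) (auto simp: F1_def)
    ultimately show ?thesis
      using H_inf_power_series(1)[OF r] by blast
  qed
  show ?thesis
    unfolding C1_hol_def norm_continuous_on_def
    using member whitney by (intro CollectI conjI exI[of _ F1]) auto
qed

section \<open>Diamonds over the components of the superlevel sets\<close>

lemma rational_in_brjuno_superlevel: "x \<in> \<rat> \<Longrightarrow> x \<in> brjuno_superlevel M"
  by (simp add: brjuno_superlevel_def brjuno_def)

text \<open>
  A component cannot jump over the translates of the golden mean.
\<close>

lemma component_superlevel_bounds:
  assumes "0 \<le> M" and V: "V \<in> components (brjuno_superlevel M)"
  shows "V \<noteq> {}" "bdd_below V" "bdd_above V" "Sup V - Inf V \<le> 1"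
    "\<And>x. Inf V < x \<Longrightarrow> x < Sup V \<Longrightarrow> x \<in> V"
proof -
  show ne: "V \<noteq> {}"
    using V by (rule in_components_nonempty)
  have conn: "connected V"
    using V by (rule in_components_connected)
  have sub: "V \<subseteq> brjuno_superlevel M"
    using V by (rule in_components_subset)
  have gold: "of_int m + golden \<notin> V" for m
    using sub brjuno_golden_translate[of m] \<open>0 \<le> M\<close> by (auto simp: brjuno_superlevel_def)
  obtain v where v: "v \<in> V"
    using ne by blast
  define m where "m = \<lfloor>v - golden\<rfloor>"
  have m: "of_int m + golden \<le> v" "v < of_int (m + 1) + golden"
    unfolding m_def by linarith+
  have V01: "of_int m + golden < x \<and> x < of_int (m + 1) + golden" if x: "x \<in> V" for x
  proof (rule ccontr)
    assume "\<not> ?thesis"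
    then consider "x \<le> of_int m + golden" | "of_int (m + 1) + golden \<le> x"
      by linarith
    then show False
    proof cases
      case 1
      then show ?thesis
        using connectedD_interval[OF conn x v, of "of_int m + golden"] m gold by auto
    next
      case 2
      then show ?thesis
        using connectedD_interval[OF conn v x, of "of_int (m + 1) + golden"] m gold[of "m + 1"] by auto
    qed
  qed
  show bb: "bdd_below V"
    using V01 by (intro bdd_belowI[of _ "of_int m + golden"]) (auto intro: less_imp_le)
  show ba: "bdd_above V"
    using V01 by (intro bdd_aboveI[of _ "of_int (m + 1) + golden"]) (auto intro: less_imp_le)
  have "of_int m + golden \<le> Inf V"
    using V01 ne by (intro cInf_greatest) (auto intro: less_imp_le)
  moreover have "Sup V \<le> of_int (m + 1) + golden"
    using V01 ne by (intro cSup_least) (auto intro: less_imp_le)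
  ultimately show "Sup V - Inf V \<le> 1"
    by simp
  show "x \<in> V" if "Inf V < x" "x < Sup V" for x
    using cInf_lessD[OF ne that(1)] less_cSupD[OF ne that(2)] connectedD_interval[OF conn]
    by (meson less_imp_le)
qed

text \<open>
  If the Brjuno function exceeded \<open>M\<close> on a one-sided neighbourhood of an end, the component would
  extend into that neighbourhood.
\<close>

lemma low_points_near_component_ends:
  assumes M: "0 \<le> M" and V: "V \<in> components (brjuno_superlevel M)" and "0 < \<epsilon>"
  shows "\<exists>y. Inf V - \<epsilon> < y \<and> y \<le> Inf V \<and> brjuno y \<le> ereal M"
    and "\<exists>y. Sup V \<le> y \<and> y < Sup V + \<epsilon> \<and> brjuno y \<le> ereal M"
proof -
  note VB = component_superlevel_bounds[OF M V]
  have sub: "V \<subseteq> brjuno_superlevel M"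
    using V by (rule in_components_subset)
  obtain v where v: "v \<in> V"
    using VB(1) by blast
  have v': "Inf V \<le> v" "v \<le> Sup V"
    using v VB by (auto intro: cInf_lower cSup_upper)
  show "\<exists>y. Inf V - \<epsilon> < y \<and> y \<le> Inf V \<and> brjuno y \<le> ereal M"
  proof (rule ccontr)
    assume "\<not> ?thesis"
    then have *: "y \<in> brjuno_superlevel M" if "Inf V - \<epsilon> < y" "y \<le> Inf V" for y
      using that by (auto simp: brjuno_superlevel_def not_le)
    have "y \<in> brjuno_superlevel M" if "y \<in> {Inf V - \<epsilon><..v}" for y
    proof (cases "y \<le> Inf V")
      case True
      then show ?thesis
        using * that by auto
    next
      case False
      then have "y \<in> V"
        using that v VB(5)[of y] v' by (cases "y = v") auto
      then show ?thesis
        using sub by blast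
    qed
    then have "{Inf V - \<epsilon><..v} \<subseteq> V"
      using v v' \<open>0 < \<epsilon>\<close> by (intro components_maximal[OF V]) auto
    moreover have "Inf V - \<epsilon> / 2 \<in> {Inf V - \<epsilon><..v}"
      using v' \<open>0 < \<epsilon>\<close> by auto
    ultimately have "Inf V \<le> Inf V - \<epsilon> / 2"
      using VB(2) by (intro cInf_lower) auto
    then show False
      using \<open>0 < \<epsilon>\<close> by simp
  qed
  show "\<exists>y. Sup V \<le> y \<and> y < Sup V + \<epsilon> \<and> brjuno y \<le> ereal M"
  proof (rule ccontr)
    assume "\<not> ?thesis"
    then have *: "y \<in> brjuno_superlevel M" if "y < Sup V + \<epsilon>" "Sup V \<le> y" for y
      using that by (auto simp: brjuno_superlevel_def not_le)
    have "y \<in> brjuno_superlevel M" if "y \<in> {v..<Sup V + \<epsilon>}" for y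
    proof (cases "Sup V \<le> y")
      case True
      then show ?thesis
        using * that by auto
    next
      case False
      then have "y \<in> V"
        using that v VB(5)[of y] v' by (cases "y = v") auto
      then show ?thesis
        using sub by blast
    qed
    then have "{v..<Sup V + \<epsilon>} \<subseteq> V"
      using v v' \<open>0 < \<epsilon>\<close> by (intro components_maximal[OF V]) auto
    moreover have "Sup V + \<epsilon> / 2 \<in> {v..<Sup V + \<epsilon>}"
      using v' \<open>0 < \<epsilon>\<close> by auto
    ultimately have "Sup V + \<epsilon> / 2 \<le> Sup V"
      using VB(3) by (intro cSup_upper) auto
    then show False
      using \<open>0 < \<epsilon>\<close> by simp
  qed
qed

text \<open>
  Lowering the level from \<open>M + \<delta>\<close> to \<open>M\<close> enlarges the component around the rational \<open>c\<close> by at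
  least \<open>\<rho>\<close> at either end. Take a point \<open>y\<close> of value at most \<open>M\<close> close to the end of the large
  component. The approximation property gives a point \<open>x\<close> of value at most \<open>M + \<delta>\<close> between \<open>y\<close> and
  \<open>c\<close>, at distance at least \<open>\<rho>\<close> from \<open>y\<close>, and the small component cannot cross \<open>x\<close>.
\<close>

lemma component_margin:
  fixes M \<delta> \<rho> :: real
  assumes M: "0 < M" "0 < \<delta>"
    and approx: "\<And>y s. brjuno y \<le> ereal M \<Longrightarrow> s = 1 \<or> s = (-1::int) \<Longrightarrow> 0 < of_int s * (c - y) \<Longrightarrow>
       \<exists>x. brjuno x \<le> ereal (M + \<delta>) \<and> 0 < of_int s * (c - x) \<and> \<rho> \<le> of_int s * (x - y)"
    and V: "V \<in> components (brjuno_superlevel M)" "c \<in> V"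
    and V': "V' \<in> components (brjuno_superlevel (M + \<delta>))" "c \<in> V'"
    and c: "c \<in> \<rat>"
  shows "Inf V + \<rho> \<le> Inf V'" "Sup V' \<le> Sup V - \<rho>"
proof -
  have M0: "0 \<le> M" "0 \<le> M + \<delta>"
    using M by auto
  note VB = component_superlevel_bounds[OF M0(1) V(1)]
  note VB' = component_superlevel_bounds[OF M0(2) V'(1)]
  have cV: "Inf V \<le> c" "c \<le> Sup V"
    using V VB by (auto intro: cInf_lower cSup_upper)
  have conn: "connected V'" and sub': "V' \<subseteq> brjuno_superlevel (M + \<delta>)"
    using V' in_components_connected in_components_subset by blast+
  have "Inf V + \<rho> \<le> Inf V' + \<epsilon>" if \<epsilon>: "0 < \<epsilon>" for \<epsilon>
  proof -
    obtain y where y: "Inf V - \<epsilon> < y" "y \<le> Inf V" "brjuno y \<le> ereal M"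
      using low_points_near_component_ends(1)[OF M0(1) V(1) \<epsilon>] by blast
    have "y \<noteq> c"
      using y(3) rational_in_brjuno_superlevel[OF c, of M] by (auto simp: brjuno_superlevel_def)
    then have "y < c"
      using y cV by simp
    then obtain x where x: "brjuno x \<le> ereal (M + \<delta>)" "x < c" "\<rho> \<le> x - y"
      using approx[OF y(3), of 1] by auto
    have xn: "x \<notin> V'"
      using x(1) sub' by (auto simp: brjuno_superlevel_def)
    have "x \<le> v" if "v \<in> V'" for v
      using connectedD_interval[OF conn that V'(2), of x] x(2) xn by (cases "v \<le> x") auto
    then have "x \<le> Inf V'"
      using VB'(1) by (intro cInf_greatest) auto
    then show ?thesis
      using x(3) y(1) by simp
  qed
  then show "Inf V + \<rho> \<le> Inf V'"
    by (rule field_le_epsilon)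
  have "Sup V' \<le> Sup V - \<rho> + \<epsilon>" if \<epsilon>: "0 < \<epsilon>" for \<epsilon>
  proof -
    obtain y where y: "Sup V \<le> y" "y < Sup V + \<epsilon>" "brjuno y \<le> ereal M"
      using low_points_near_component_ends(2)[OF M0(1) V(1) \<epsilon>] by blast
    have "y \<noteq> c"
      using y(3) rational_in_brjuno_superlevel[OF c, of M] by (auto simp: brjuno_superlevel_def)
    then have "c < y"
      using y cV by simp
    then obtain x where x: "brjuno x \<le> ereal (M + \<delta>)" "c < x" "\<rho> \<le> y - x"
      using approx[OF y(3), of "-1"] by auto
    have xn: "x \<notin> V'"
      using x(1) sub' by (auto simp: brjuno_superlevel_def)
    have "v \<le> x" if "v \<in> V'" for v
      using connectedD_interval[OF conn V'(2) that, of x] x(2) xn by (cases "x \<le> v") auto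
    then have "Sup V' \<le> x"
      using VB'(1) by (intro cSup_least) auto
    then show ?thesis
      using x(3) y(2) by simp
  qed
  then show "Sup V' \<le> Sup V - \<rho>"
    by (rule field_le_epsilon)
qed

text \<open>
  The function \<open>\<kappa> min (Re z - Inf V) (Sup V - Re z) - \<bar>Im z\<bar>\<close>, which is positive exactly on the
  diamond, changes by at most \<open>2 \<bar>z - w\<bar>\<close>, and it is at least \<open>\<kappa> \<rho>\<close> on the closed inner diamond.
\<close>

lemma diamond_separation:
  assumes \<kappa>: "0 < \<kappa>" "\<kappa> < 1" and \<rho>: "0 < \<rho>"
    and V: "Inf V + \<rho> \<le> Inf V'" "Sup V' \<le> Sup V - \<rho>"
    and z: "Inf V' \<le> Re z" "Re z \<le> Sup V'" "\<bar>Im z\<bar> \<le> \<kappa> * min (Re z - Inf V') (Sup V' - Re z)"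
    and w: "w \<notin> diamond \<kappa> V"
  shows "\<kappa> * \<rho> / 2 \<le> cmod (z - w)"
proof (rule ccontr)
  assume "\<not> ?thesis"
  then have lt: "cmod (z - w) < \<kappa> * \<rho> / 2"
    by simp
  have re: "\<bar>Re z - Re w\<bar> < \<kappa> * \<rho> / 2" and im: "\<bar>Im z - Im w\<bar> < \<kappa> * \<rho> / 2"
    using le_less_trans[OF abs_Re_le_cmod lt] le_less_trans[OF abs_Im_le_cmod lt] by auto
  have "\<kappa> * \<rho> \<le> 1 * \<rho>"
    using \<kappa> \<rho> by (intro mult_right_mono) auto
  then have re': "\<bar>Re z - Re w\<bar> \<le> \<rho> / 2"
    using re by linarith
  have zi: "\<bar>Im z\<bar> \<le> \<kappa> * (Re z - Inf V')" "\<bar>Im z\<bar> \<le> \<kappa> * (Sup V' - Re z)"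
    using z(3) \<kappa> by (auto intro: order_trans mult_left_mono)
  have "\<kappa> * (Re z - Inf V' + \<rho> / 2) \<le> \<kappa> * (Re w - Inf V)" "\<kappa> * (Sup V' - Re z + \<rho> / 2) \<le> \<kappa> * (Sup V - Re w)"
    using re' V \<kappa> by (intro mult_left_mono; linarith)+
  then have "\<bar>Im w\<bar> < \<kappa> * (Re w - Inf V)" "\<bar>Im w\<bar> < \<kappa> * (Sup V - Re w)"
    using zi im unfolding distrib_left by linarith+
  moreover have "Inf V < Re w" "Re w < Sup V"
    using re' V z \<rho> by linarith+
  ultimately show False
    using w by (auto simp: diamond_def min_def split: if_split_asm)
qed

lemma open_diamond: "open (diamond \<kappa> V)"
  unfolding diamond_def by (intro open_Collect_conj open_Collect_less continuous_intros)

lemma closure_diamond_subset: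
  "closure (diamond \<kappa> V) \<subseteq> {z. Inf V \<le> Re z \<and> Re z \<le> Sup V}"
  by (rule closure_minimal) (auto simp: diamond_def intro!: closed_Collect_conj closed_Collect_le continuous_intros)

text \<open>
  A boundary point of one diamond is in no other, since diamonds project to disjoint open intervals.
\<close>

lemma frontier_diamond_subset_K_set:
  assumes M: "0 \<le> M" and V: "V \<in> components (brjuno_superlevel M)"
  shows "frontier (diamond \<kappa> V) \<subseteq> K_set \<kappa> M"
proof
  fix w assume w: "w \<in> frontier (diamond \<kappa> V)"
  then have re: "Inf V \<le> Re w" "Re w \<le> Sup V" and nd: "w \<notin> diamond \<kappa> V"
    using closure_diamond_subset[of \<kappa> V] open_diamond[of \<kappa> V] by (auto simp: frontier_def interior_open)
  note VB = component_superlevel_bounds[OF M V]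
  show "w \<in> K_set \<kappa> M"
  proof (rule ccontr)
    assume "w \<notin> K_set \<kappa> M"
    then obtain W where W: "W \<in> components (brjuno_superlevel M)" "w \<in> diamond \<kappa> W"
      by (auto simp: K_set_def)
    note WB = component_superlevel_bounds[OF M W(1)]
    have reW: "Inf W < Re w" "Re w < Sup W"
      using W(2) by (auto simp: diamond_def)
    have "V \<inter> W \<noteq> {}"
    proof -
      consider "Re w = Inf V" | "Re w = Sup V" | "Re w \<in> V"
        using VB(5)[of "Re w"] re by fastforce
      then show ?thesis
      proof cases
        case 1
        then obtain v where "v \<in> V" "v < Sup W"
          using cInf_lessD[OF VB(1), of "Sup W"] reW by auto
        moreover have "Re w \<le> v"
          using cInf_lower[OF \<open>v \<in> V\<close> VB(2)] 1 by simp
        ultimately show ?thesis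
          using WB(5)[of v] reW by auto
      next
        case 2
        then obtain v where "v \<in> V" "Inf W < v"
          using less_cSupD[OF VB(1), of "Inf W"] reW by auto
        moreover have "v \<le> Re w"
          using cSup_upper[OF \<open>v \<in> V\<close> VB(3)] 2 by simp
        ultimately show ?thesis
          using WB(5)[of v] reW by auto
      next
        case 3
        then show ?thesis
          using WB(5)[of "Re w"] reW by auto
      qed
    qed
    then have "V = W"
      using components_nonoverlap[OF V W(1)] by auto
    then show False
      using nd W(2) by simp
  qed
qed

text \<open>
  The Brjuno function is infinite at \<open>c\<close>, so \<open>c\<close> can be joined to the component.
\<close>

lemma rational_closure_component:
  assumes M: "0 \<le> M" and V: "V \<in> components (brjuno_superlevel M)"
    and c: "c \<in> \<rat>" "Inf V \<le> c" "c \<le> Sup V"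
  shows "c \<in> V"
proof -
  note VB = component_superlevel_bounds[OF M V]
  have sub: "V \<subseteq> brjuno_superlevel M"
    using V by (rule in_components_subset)
  obtain v where v: "v \<in> V"
    using VB(1) by blast
  have v': "Inf V \<le> v" "v \<le> Sup V"
    using v VB by (auto intro: cInf_lower cSup_upper)
  define T where "T = closed_segment v c"
  have "x \<in> brjuno_superlevel M" if x: "x \<in> T" for x
  proof -
    have "x = c \<or> x = v \<or> (Inf V < x \<and> x < Sup V)"
      using x v' c(2,3) by (auto simp: T_def closed_segment_eq_real_ivl split: if_splits)
    then show ?thesis
      using rational_in_brjuno_superlevel[OF c(1)] VB(5)[of x] v sub by blast
  qed
  then have "T \<subseteq> V"
    using v by (intro components_maximal[OF V]) (auto simp: T_def)
  then show ?thesis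
    by (auto simp: T_def)
qed

section \<open>The maximum principle and the two charts of the sphere\<close>

text \<open>
  In the coordinate \<open>\<zeta>\<close> with \<open>\<lambda> = exp (2 \<pi> \<i> \<zeta>)\<close>, a set that contains all poles of the
  \<open>k\<close>-th coefficient.
\<close>

definition low_fractions :: "nat \<Rightarrow> complex set" where
  "low_fractions k = {of_real (of_int p / of_int q) | p q. 1 \<le> q \<and> q \<le> int k}"

text \<open>
  Let \<open>z\<close> lie in the diamond over a component \<open>V'\<close> of the superlevel set of \<open>M + \<delta>\<close>. If \<open>V'\<close>
  contains a fraction with denominator at most \<open>k\<close>, then by \<open>component_margin\<close> the diamond over
  \<open>V'\<close> is too deep inside a diamond of level \<open>M\<close> for \<open>z\<close> to be that close to \<open>w\<close>. Otherwise \<open>h\<close> is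
  holomorphic on the closed diamond, whose boundary is in \<open>K_set \<kappa> (M + \<delta>)\<close>, and the maximum
  principle applies.
\<close>

lemma K_set_maximum_principle:
  assumes M: "0 < M" "0 < \<delta>" and \<kappa>: "0 < \<kappa>" "\<kappa> < 1" and \<rho>: "0 < \<rho>"
    and approx: "\<And>y p q s. brjuno y \<le> ereal M \<Longrightarrow> 1 \<le> q \<Longrightarrow> q \<le> int k \<Longrightarrow> s = 1 \<or> s = (-1::int) \<Longrightarrow>
       0 < of_int s * (of_int p / of_int q - y) \<Longrightarrow>
       \<exists>x. brjuno x \<le> ereal (M + \<delta>) \<and> 0 < of_int s * (of_int p / of_int q - x) \<and> \<rho> \<le> of_int s * (x - y)"
    and hol: "h holomorphic_on - low_fractions k"
    and bound: "\<And>z. z \<in> K_set \<kappa> (M + \<delta>) \<Longrightarrow> cmod (h z) \<le> B"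
    and w: "w \<in> K_set \<kappa> M" and z: "cmod (z - w) < \<kappa> * \<rho> / 2"
  shows "z \<notin> low_fractions k" "cmod (h z) \<le> B"
proof -
  have M0: "0 \<le> M" "0 \<le> M + \<delta>"
    using M by auto
  have no_low: False
    if V': "V' \<in> components (brjuno_superlevel (M + \<delta>))" and c: "1 \<le> q" "q \<le> int k" "of_int p / of_int q \<in> V'"
      and zV': "Inf V' \<le> Re z" "Re z \<le> Sup V'" "\<bar>Im z\<bar> \<le> \<kappa> * min (Re z - Inf V') (Sup V' - Re z)"
    for V' p q
  proof -
    let ?c = "of_int p / of_int q :: real"
    have cQ: "?c \<in> \<rat>"
      by simp
    then obtain V where V: "V \<in> components (brjuno_superlevel M)" "?c \<in> V"
      using rational_in_brjuno_superlevel[OF cQ, of M] by (metis UnionE Union_components)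
    have "Inf V + \<rho> \<le> Inf V'" "Sup V' \<le> Sup V - \<rho>"
      using component_margin[OF M approx[OF _ c(1,2)] V V' c(3) cQ] by auto
    moreover have "w \<notin> diamond \<kappa> V"
      using w V(1) by (auto simp: K_set_def)
    ultimately have "\<kappa> * \<rho> / 2 \<le> cmod (z - w)"
      using diamond_separation[OF \<kappa> \<rho> _ _ zV'] by blast
    then show False
      using z by simp
  qed
  show "z \<notin> low_fractions k"
  proof
    assume "z \<in> low_fractions k"
    then obtain p q where c: "z = of_real (of_int p / of_int q)" "1 \<le> q" "q \<le> int k"
      by (auto simp: low_fractions_def)
    let ?c = "of_int p / of_int q :: real"
    obtain V' where V': "V' \<in> components (brjuno_superlevel (M + \<delta>))" "?c \<in> V'"
      using rational_in_brjuno_superlevel[of ?c "M + \<delta>"] by (metis UnionE Union_components Rats_divide Rats_of_int)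
    note VB = component_superlevel_bounds[OF M0(2) V'(1)]
    have "Inf V' \<le> ?c" "?c \<le> Sup V'"
      using V' VB by (auto intro: cInf_lower cSup_upper)
    then show False
      using no_low[OF V'(1) c(2,3) V'(2)] c(1) \<kappa> by simp
  qed
  show "cmod (h z) \<le> B"
  proof (cases "z \<in> K_set \<kappa> (M + \<delta>)")
    case True
    then show ?thesis
      by (rule bound)
  next
    case False
    then obtain V' where V': "V' \<in> components (brjuno_superlevel (M + \<delta>))" "z \<in> diamond \<kappa> V'"
      by (auto simp: K_set_def)
    have zV': "Inf V' \<le> Re z" "Re z \<le> Sup V'" "\<bar>Im z\<bar> \<le> \<kappa> * min (Re z - Inf V') (Sup V' - Re z)"
      using V'(2) by (auto simp: diamond_def)
    have disj: "closure (diamond \<kappa> V') \<subseteq> - low_fractions k"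
    proof
      fix u assume "u \<in> closure (diamond \<kappa> V')"
      then have u: "Inf V' \<le> Re u" "Re u \<le> Sup V'"
        using closure_diamond_subset by blast+
      show "u \<in> - low_fractions k"
      proof
        assume "u \<in> low_fractions k"
        then obtain p q where c: "u = of_real (of_int p / of_int q)" "1 \<le> q" "q \<le> int k"
          by (auto simp: low_fractions_def)
        then have "of_int p / of_int q \<in> V'"
          using rational_closure_component[OF M0(2) V'(1), of "of_int p / of_int q"] u by simp
        then show False
          using no_low[OF V'(1) c(2,3) _ zV'] by blast
      qed
    qed
    show ?thesis
    proof (rule maximum_modulus_frontier[of h "diamond \<kappa> V'"])
      have "diamond \<kappa> V' \<subseteq> - low_fractions k"
        using disj closure_subset by blast
      then show "h holomorphic_on interior (diamond \<kappa> V')"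
        using holomorphic_on_subset[OF hol] by (simp add: interior_open open_diamond)
      show "continuous_on (closure (diamond \<kappa> V')) h"
        using holomorphic_on_imp_continuous_on[OF holomorphic_on_subset[OF hol disj]] .
      have "cmod u \<le> \<bar>Inf V'\<bar> + \<bar>Sup V'\<bar> + \<kappa> * (Sup V' - Inf V')" if "u \<in> diamond \<kappa> V'" for u
      proof -
        have u: "Inf V' < Re u" "Re u < Sup V'" "\<bar>Im u\<bar> \<le> \<kappa> * (Re u - Inf V')"
          using that \<kappa> by (auto simp: diamond_def intro: order_trans[OF less_imp_le] mult_left_mono)
        have "\<kappa> * (Re u - Inf V') \<le> \<kappa> * (Sup V' - Inf V')"
          using u \<kappa> by (intro mult_left_mono) auto
        then show ?thesis
          using u cmod_le[of u] by linarith
      qed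
      then show "bounded (diamond \<kappa> V')"
        unfolding bounded_iff by blast
      show "cmod (h u) \<le> B" if "u \<in> frontier (diamond \<kappa> V')" for u
        using bound frontier_diamond_subset_K_set[OF M0(2) V'(1)] that by blast
    qed (rule V'(2))
  qed
qed

text \<open>
  For \<open>s = 1\<close> this parametrizes the chart \<open>\<lambda>\<close> of the sphere, for \<open>s = -1\<close> the chart \<open>1/\<lambda>\<close>.
\<close>

definition unit_map :: "real \<Rightarrow> complex \<Rightarrow> complex" where
  "unit_map s \<zeta> = exp (2 * of_real pi * \<i> * of_real s * \<zeta>)"

text \<open>
  The centre \<open>0\<close> of the chart represents the point \<open>0\<close> or the point at infinity.
\<close>

definition chart_set :: "real \<Rightarrow> real \<Rightarrow> real \<Rightarrow> complex set" where
  "chart_set s \<kappa> M = insert 0 (unit_map s ` K_set \<kappa> M)"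

lemma vimage_Some_C_set: "Some -` C_set \<kappa> M = chart_set 1 \<kappa> M"
  by (auto simp: C_set_def chart_set_def unit_map_def)

lemma vimage_chart_infinity_C_set: "chart_infinity -` C_set \<kappa> M = chart_set (-1) \<kappa> M"
proof -
  have "1 / w = exp u \<longleftrightarrow> w = exp (- u)" if "w \<noteq> 0" for w u :: complex
    using that by (auto simp: exp_minus field_simps)
  then show ?thesis
    by (auto simp: C_set_def chart_set_def unit_map_def chart_infinity_def split: if_splits)
qed

lemma unit_map_root_of_unity:
  assumes s: "s = 1 \<or> s = -1" and j: "1 \<le> j" "j \<le> k" and eq: "unit_map s \<zeta> ^ j = 1"
  shows "\<zeta> \<in> low_fractions k"
proof -
  have "exp (of_nat j * (2 * of_real pi * \<i> * of_real s * \<zeta>)) = 1"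
    using eq by (simp add: unit_map_def exp_of_nat_mult)
  then obtain n :: int where n: "of_nat j * (2 * of_real pi * \<i> * of_real s * \<zeta>) = of_real (of_int (2 * n) * pi) * \<i>"
    unfolding exp_eq_1 by (metis add_0 complex_eq mult.commute of_real_0)
  have "of_nat j * of_real s * \<zeta> = of_int n"
  proof -
    have "(2 * of_real pi * \<i>) * (of_nat j * of_real s * \<zeta>) = (2 * of_real pi * \<i>) * of_int n"
      using n by (simp add: mult_ac)
    then show ?thesis
      by simp
  qed
  then have "of_nat j * \<zeta> = of_int (n * (if s = 1 then 1 else - 1))"
    using s by (auto simp: minus_equation_iff[of "of_nat j * \<zeta>"])
  then have "\<zeta> = of_real (of_int (n * (if s = 1 then 1 else - 1)) / of_int (int j))"
    using j by (simp add: nonzero_eq_divide_eq mult.commute)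
  then show ?thesis
    unfolding low_fractions_def using j by (intro CollectI exI[of _ "n * (if s = 1 then 1 else - 1)"] exI[of _ "int j"]) auto
qed

text \<open>
  The components have length at most \<open>1\<close>, so the diamonds have height less than \<open>1/2\<close>, whereas
  \<open>\<bar>\<lambda>\<bar> < exp (-\<pi>)\<close> means \<open>\<bar>Im \<zeta>\<bar> > 1/2\<close>.
\<close>

lemma small_in_chart_set:
  assumes s: "s = 1 \<or> s = -1" and M: "0 \<le> M" and \<kappa>: "0 < \<kappa>" "\<kappa> < 1" and lam: "cmod lam < exp (- pi)"
  shows "lam \<in> chart_set s \<kappa> M"
proof (cases "lam = 0")
  case False
  define \<zeta> where "\<zeta> = Ln lam / (2 * of_real pi * \<i> * of_real s)"
  have s0: "s \<noteq> 0" "\<bar>s\<bar> = 1"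
    using s by auto
  have eq: "unit_map s \<zeta> = lam"
    using s0 False by (simp add: unit_map_def \<zeta>_def)
  have "cmod lam = exp (Re (2 * of_real pi * \<i> * of_real s * \<zeta>))"
    unfolding eq[symmetric] unit_map_def by (rule norm_exp_eq_Re)
  also have "Re (2 * of_real pi * \<i> * of_real s * \<zeta>) = - (2 * pi * s * Im \<zeta>)"
    by simp
  finally have "- (2 * pi * s * Im \<zeta>) < - pi"
    using lam by simp
  then have "pi * 1 < pi * (2 * (s * Im \<zeta>))"
    by (simp add: mult_ac)
  then have "1 < 2 * (s * Im \<zeta>)"
    using pi_gt_zero by (simp only: mult_less_cancel_left_pos)
  then have im: "1 / 2 < \<bar>Im \<zeta>\<bar>"
    using s by auto
  have "\<zeta> \<in> K_set \<kappa> M"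
  proof (rule ccontr)
    assume "\<not> ?thesis"
    then obtain V where V: "V \<in> components (brjuno_superlevel M)" "\<zeta> \<in> diamond \<kappa> V"
      by (auto simp: K_set_def)
    have "min (Re \<zeta> - Inf V) (Sup V - Re \<zeta>) \<le> 1 / 2"
      using component_superlevel_bounds(4)[OF M V(1)] by (auto simp: min_def)
    moreover have "0 \<le> min (Re \<zeta> - Inf V) (Sup V - Re \<zeta>)"
      using V(2) by (auto simp: diamond_def)
    ultimately have "\<kappa> * min (Re \<zeta> - Inf V) (Sup V - Re \<zeta>) \<le> 1 * (1 / 2)"
      using \<kappa> by (intro mult_mono) auto
    then show False
      using V(2) im by (auto simp: diamond_def)
  qed
  then show ?thesis
    using eq by (auto simp: chart_set_def)
qed (simp add: chart_set_def)

section \<open>The linearization\<close>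

text \<open>
  The recursion with a general factor \<open>c\<^sub>k\<close> in place of the small divisor \<open>1 / (\<lambda>^(k-1) - 1)\<close>, so that
  it applies in both charts.
\<close>

lemma holomorphic_lin_recursion:
  fixes g c :: "nat \<Rightarrow> complex \<Rightarrow> complex"
  assumes g0: "\<And>w. g 0 w = 0" and g1: "\<And>w. g 1 w = 1"
    and rec: "\<And>k w. 2 \<le> k \<Longrightarrow> g k w = c k w * (\<Sum>j=2..k. f j * (\<Sum>\<epsilon>\<in>compositions j k. \<Prod>i\<leftarrow>\<epsilon>. g i w))"
    and c: "\<And>k. 2 \<le> k \<Longrightarrow> c k holomorphic_on {w. w ^ (k - 1) \<noteq> 1}"
  shows "g k holomorphic_on {w. \<forall>j. 1 \<le> j \<and> j < k \<longrightarrow> w ^ j \<noteq> 1}"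
proof (induction k rule: less_induct)
  case (less k)
  let ?D = "\<lambda>k. {w::complex. \<forall>j. 1 \<le> j \<and> j < k \<longrightarrow> w ^ j \<noteq> 1}"
  consider "k = 0" | "k = 1" | "2 \<le> k"
    by linarith
  then show ?case
  proof cases
    case 1
    then show ?thesis
      using g0 by (simp add: holomorphic_on_const cong: holomorphic_cong)
  next
    case 2
    then show ?thesis
      using g1 by (simp add: holomorphic_on_const cong: holomorphic_cong)
  next
    case 3
    have prod: "(\<lambda>w. \<Prod>i\<leftarrow>\<epsilon>. g i w) holomorphic_on ?D k" if "\<forall>i\<in>set \<epsilon>. i < k" for \<epsilon>
      using that
    proof (induction \<epsilon>)
      case (Cons i \<epsilon>)
      have "g i holomorphic_on ?D k"
        using Cons.prems by (intro holomorphic_on_subset[OF less.IH[of i]]) auto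
      then show ?case
        using Cons by (auto intro!: holomorphic_intros)
    qed auto
    have "c k holomorphic_on ?D k"
      using 3 by (intro holomorphic_on_subset[OF c[OF 3]]) auto
    then have "(\<lambda>w. c k w * (\<Sum>j=2..k. f j * (\<Sum>\<epsilon>\<in>compositions j k. \<Prod>i\<leftarrow>\<epsilon>. g i w))) holomorphic_on ?D k"
      using compositions_less by (intro holomorphic_intros prod) auto
    then show ?thesis
      using rec[OF 3] by (simp cong: holomorphic_cong)
  qed
qed

lemma lin_coeff_rec:
  assumes "2 \<le> k"
  shows "lin_coeff f lam k = 1 / (lam ^ (k - 1) - 1) *
     (\<Sum>j=2..k. f j * (\<Sum>\<epsilon>\<in>compositions j k. \<Prod>i\<leftarrow>\<epsilon>. lin_coeff f lam i))"
  using assms by (subst lin_coeff.simps) auto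

lemma lin_coeff_0_1 [simp]: "lin_coeff f lam 0 = 0" "lin_coeff f lam (Suc 0) = 1"
  by (simp_all add: lin_coeff.simps)

lemma holomorphic_lin_coeff:
  "(\<lambda>lam. lin_coeff f lam k) holomorphic_on {w. \<forall>j. 1 \<le> j \<and> j < k \<longrightarrow> w ^ j \<noteq> 1}"
proof (rule holomorphic_lin_recursion[where c = "\<lambda>k w. 1 / (w ^ (k - 1) - 1)" and f = f])
  show "(\<lambda>w. 1 / (w ^ (k - 1) - 1)) holomorphic_on {w. w ^ (k - 1) \<noteq> 1}" for k
    by (intro holomorphic_intros) auto
qed (simp_all only: lin_coeff_rec lin_coeff_0_1 One_nat_def)

text \<open>
  At \<open>\<lambda> = 1/w\<close> the factor \<open>1 / (\<lambda>^(k-1) - 1)\<close> of the recursion equals \<open>w^(k-1) / (1 - w^(k-1))\<close>. In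
  this form the recursion makes sense at \<open>w = 0\<close> and gives \<open>h\<^sub>k = 0\<close> there for \<open>k \<ge> 2\<close>, in accordance
  with the value \<open>z\<close> of the linearization at infinity.
\<close>

lemma holomorphic_lin_coeff_infinity:
  "(\<lambda>w. fps_nth (linearization f (chart_infinity w)) k) holomorphic_on
     {w. \<forall>j. 1 \<le> j \<and> j < k \<longrightarrow> w ^ j \<noteq> 1}"
proof (rule holomorphic_lin_recursion[where c = "\<lambda>k w. w ^ (k - 1) / (1 - w ^ (k - 1))" and f = f])
  fix k :: nat and w :: complex
  assume k: "2 \<le> k"
  show "fps_nth (linearization f (chart_infinity w)) k = w ^ (k - 1) / (1 - w ^ (k - 1)) *
     (\<Sum>j=2..k. f j * (\<Sum>\<epsilon>\<in>compositions j k. \<Prod>i\<leftarrow>\<epsilon>. fps_nth (linearization f (chart_infinity w)) i))"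
  proof (cases "w = 0")
    case True
    then show ?thesis
      using k by (simp add: chart_infinity_def)
  next
    case False
    then have "1 / ((1 / w) ^ (k - 1) - 1) = w ^ (k - 1) / (1 - w ^ (k - 1))"
      by (simp add: power_one_over divide_simps)
    then show ?thesis
      using False lin_coeff_rec[OF k, of f "1 / w"] by (simp add: chart_infinity_def)
  qed
qed (auto intro!: holomorphic_intros simp: chart_infinity_def)

lemma unit_map_nearby:
  assumes s: "s = 1 \<or> s = -1" and u: "cmod u < 1 / 2"
  shows "\<exists>\<zeta>'. unit_map s \<zeta>' = unit_map s \<zeta> * (1 + u) \<and> cmod (\<zeta>' - \<zeta>) \<le> cmod u"
proof -
  define v where "v = Ln (1 + u) / (2 * of_real pi * \<i> * of_real s)"
  have s0: "s \<noteq> 0" "\<bar>s\<bar> = 1"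
    using s by auto
  have "1 + u \<noteq> 0"
    using u by (metis add.inverse_inverse add_eq_0_iff norm_minus_cancel norm_one less_divide_eq_1_pos not_less one_le_numeral zero_less_numeral)
  then have 1: "unit_map s (\<zeta> + v) = unit_map s \<zeta> * (1 + u)"
    using s0 by (simp add: unit_map_def v_def distrib_left exp_add)
  have "cmod (Ln (1 + u)) \<le> 2 * cmod u"
    using u by (intro norm_Ln_le) auto
  moreover have "cmod v = cmod (Ln (1 + u)) / (2 * pi)"
    using s0 by (simp add: v_def norm_divide norm_mult)
  moreover have "2 * cmod u / (2 * pi) \<le> 2 * cmod u / 2"
    using pi_ge_two by (intro divide_left_mono) auto
  ultimately have "cmod v \<le> cmod u"
    using divide_right_mono[of "cmod (Ln (1 + u))" "2 * cmod u" "2 * pi"] by simp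
  then show ?thesis
    using 1 by (intro exI[of _ "\<zeta> + v"]) auto
qed

lemma summable_cubic_exp:
  fixes c :: real
  assumes "0 < c"
  shows "summable (\<lambda>k. (real k + 1) ^ 3 * exp (- c * real k))"
proof (rule summable_comparison_test_bigo)
  show "summable (\<lambda>k. norm (1 / real k ^ 2))"
    using inverse_power_summable[of 2, where 'a = real] by (simp add: inverse_eq_divide)
  show "(\<lambda>k. (real k + 1) ^ 3 * exp (- c * real k)) \<in> O(\<lambda>k. 1 / real k ^ 2)"
    using assms by real_asymp
qed

text \<open>
  Near the centre of the chart a whole disk belongs to the chart set, and constant radii \<open>\<rho>\<^sub>k\<close> do.
  Near any other point, \<open>\<zeta>\<close> is a Lipschitz coordinate, and a disk of radius comparable to the margin
  \<open>\<kappa> R\<^sub>k / 2\<close> is admissible by \<open>K_set_maximum_principle\<close> with \<open>\<delta> = M/2\<close>. The exponents then add up to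
  \<open>(3M/2 + b) - (3M + b) + M = -M/2\<close>.
\<close>

lemma local_bounds_in_chart:
  fixes g :: "nat \<Rightarrow> complex \<Rightarrow> complex" and M b \<kappa> s :: real
  assumes s: "s = 1 \<or> s = -1" and M: "0 < M" and \<kappa>: "0 < \<kappa>" "\<kappa> < 1"
    and hol: "\<And>k. g k holomorphic_on {w. \<forall>j. 1 \<le> j \<and> j < k \<longrightarrow> w ^ j \<noteq> 1}"
    and bound: "\<And>k w. w \<in> chart_set s \<kappa> (M + M / 2) \<Longrightarrow> cmod (g k w) \<le> exp ((M + M / 2 + b) * real k)"
    and r: "r = exp (- (3 * M + b))"
    and lam0: "lam0 \<in> chart_set s \<kappa> M"
  shows "\<exists>\<delta>>0. \<exists>m \<rho>. (\<forall>k. 0 < \<rho> k \<and> \<rho> k \<le> 1) \<and>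
       summable (\<lambda>k. m k / \<rho> k * r ^ k) \<and>
       (\<forall>lam\<in>chart_set s \<kappa> M. dist lam lam0 < \<delta> \<longrightarrow>
          (\<forall>k. g k holomorphic_on ball lam (\<rho> k) \<and> (\<forall>z\<in>ball lam (\<rho> k). cmod (g k z) \<le> m k)))"
proof -
  have M2: "0 < M / 2" "0 \<le> M + M / 2"
    using M by auto
  define m where "m k = exp ((M + M / 2 + b) * real k)" for k
  have mr: "m k * r ^ k = exp (- (3 * M / 2) * real k)" for k
  proof -
    have "m k * r ^ k = exp ((M + M / 2 + b) * real k + real k * (- (3 * M + b)))"
      by (simp only: m_def r exp_add exp_of_nat_mult)
    also have "(M + M / 2 + b) * real k + real k * (- (3 * M + b)) = - (3 * M / 2) * real k"
      by (simp add: algebra_simps)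
    finally show ?thesis .
  qed
  show ?thesis
  proof (cases "lam0 = 0")
    case True
    let ?e = "exp (- pi) / 2"
    have e: "0 < ?e" "?e \<le> 1"
      using pi_gt_zero by (auto intro: order_trans[of _ 1])
    have sm: "summable (\<lambda>k. m k / ?e * r ^ k)"
    proof -
      have "summable (\<lambda>k. exp (- (3 * M / 2)) ^ k / ?e)"
        using M by (intro summable_divide summable_geometric) auto
      moreover have "m k * r ^ k = exp (- (3 * M / 2)) ^ k" for k
        unfolding mr by (simp add: exp_of_nat_mult[symmetric] mult.commute)
      ultimately show ?thesis
        by (simp only: times_divide_eq_left)
    qed
    have ball: "z \<in> chart_set s \<kappa> (M + M / 2) \<and> cmod z < 1" if "dist lam lam0 < ?e" "z \<in> ball lam ?e" for lam z
    proof -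
      have "cmod z < exp (- pi)"
        using that True norm_triangle_ineq4[of lam "lam - z"] by (auto simp: dist_norm)
      moreover have "exp (- pi) < 1"
        by simp
      ultimately show ?thesis
        using small_in_chart_set[OF s M2(2) \<kappa>] by (meson less_trans)
    qed
    have "w ^ j \<noteq> 1" if "cmod w < 1" "1 \<le> j" for w :: complex and j
      using that power_less_one_iff[of "cmod w" j] by (metis less_irrefl norm_ge_zero norm_one norm_power not_one_le_zero neq0_conv)
    then have "g k holomorphic_on ball lam ?e" if "dist lam lam0 < ?e" for lam k
      using ball[OF that] by (intro holomorphic_on_subset[OF hol]) auto
    moreover have "cmod (g k z) \<le> m k" if "dist lam lam0 < ?e" "z \<in> ball lam ?e" for lam z k
      using ball[OF that] bound unfolding m_def by blast
    ultimately show ?thesis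
      using e sm by (intro exI[of _ ?e] conjI exI[of _ m] exI[of _ "\<lambda>_. ?e"]) auto
  next
    case False
    obtain C0 where C0: "0 < C0" and approx0: "\<And>y p q k s. brjuno y \<le> ereal M \<Longrightarrow> 1 \<le> q \<Longrightarrow> q \<le> int k \<Longrightarrow> s = 1 \<or> s = (-1::int) \<Longrightarrow>
       0 < of_int s * (of_int p / of_int q - y) \<Longrightarrow>
       \<exists>x. brjuno x \<le> ereal (M + M / 2) \<and> 0 < of_int s * (of_int p / of_int q - x) \<and>
           C0 * exp (- M * real k) / (real k + 1) ^ 3 \<le> of_int s * (x - y)"
      using one_sided_approximation[OF M M2(1)] by blast
    \<comment> \<open>Capping the constant keeps the perturbation \<open>u\<close> below within the domain of the logarithm.\<close>
    define C where "C = min C0 1"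
    have C: "0 < C" "C \<le> C0" "C \<le> 1"
      using C0 by (auto simp: C_def)
    define R where "R k = C * exp (- M * real k) / (real k + 1) ^ 3" for k
    have R: "0 < R k" "R k \<le> 1" "R k \<le> C0 * exp (- M * real k) / (real k + 1) ^ 3" for k
    proof -
      show "0 < R k"
        using C by (simp add: R_def)
      show "R k \<le> C0 * exp (- M * real k) / (real k + 1) ^ 3"
        unfolding R_def using C by (intro divide_right_mono mult_right_mono) auto
      have "R k \<le> 1 / 1"
        unfolding R_def using C M by (intro frac_le mult_le_one) auto
      then show "R k \<le> 1"
        by simp
    qed
    define t where "t = min 1 (cmod lam0 / 2)"
    have t: "0 < t" "t \<le> 1" "t \<le> cmod lam0 / 2"
      using False by (auto simp: t_def)
    define \<rho> where "\<rho> k = t * (\<kappa> * R k / 2)" for k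
    have \<kappa>R: "0 < \<kappa> * R k / 2" "\<kappa> * R k / 2 < 1 / 2" for k
    proof -
      have "\<kappa> * R k \<le> \<kappa> * 1"
        using R(2)[of k] \<kappa> by (intro mult_left_mono) auto
      then show "\<kappa> * R k / 2 < 1 / 2"
        using \<kappa>(2) by linarith
    qed (use \<kappa> R in simp)
    have \<rho>: "0 < \<rho> k" "\<rho> k \<le> 1" for k
    proof -
      show "0 < \<rho> k"
        unfolding \<rho>_def using t \<kappa>R by (intro mult_pos_pos) auto
      show "\<rho> k \<le> 1"
        unfolding \<rho>_def using t \<kappa>R[of k] by (intro mult_le_one) auto
    qed
    have sm: "summable (\<lambda>k. m k / \<rho> k * r ^ k)"
    proof -
      have "m k / \<rho> k * r ^ k = 2 / (t * \<kappa> * C) * ((real k + 1) ^ 3 * exp (- (M / 2) * real k))" for k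
      proof -
        have "m k / \<rho> k * r ^ k = 2 / (t * \<kappa> * C) * ((real k + 1) ^ 3 * (m k * r ^ k / exp (- M * real k)))"
          by (simp add: \<rho>_def R_def field_simps)
        also have "m k * r ^ k / exp (- M * real k) = exp (- (M / 2) * real k)"
          unfolding mr exp_diff[symmetric] by (simp add: algebra_simps)
        finally show ?thesis .
      qed
      then show ?thesis
        using summable_mult[OF summable_cubic_exp[of "M / 2"]] M by simp
    qed
    have near: "(\<forall>j. 1 \<le> j \<and> j < k \<longrightarrow> z ^ j \<noteq> 1) \<and> cmod (g k z) \<le> m k"
      if lam: "lam \<in> chart_set s \<kappa> M" "dist lam lam0 < cmod lam0 / 2" and z: "z \<in> ball lam (\<rho> k)" for lam z k
    proof -
      have lam_ge: "cmod lam0 / 2 < cmod lam"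
        using lam(2) norm_triangle_ineq4[of lam "lam - lam0"] by (auto simp: dist_norm)
      then have "lam \<noteq> 0"
        by auto
      then obtain \<zeta> where \<zeta>: "\<zeta> \<in> K_set \<kappa> M" "lam = unit_map s \<zeta>"
        using lam(1) by (auto simp: chart_set_def)
      define u where "u = (z - lam) / lam"
      have zu: "z = lam * (1 + u)"
        using \<open>lam \<noteq> 0\<close> by (simp add: u_def field_simps)
      have "cmod (z - lam) < \<rho> k"
        using z by (simp add: dist_norm norm_minus_commute)
      also have "\<rho> k \<le> cmod lam * (\<kappa> * R k / 2)"
        unfolding \<rho>_def using t lam_ge \<kappa>R[of k] by (intro mult_right_mono) auto
      finally have u: "cmod u < \<kappa> * R k / 2"
        using \<open>lam \<noteq> 0\<close> by (simp add: u_def norm_divide pos_divide_less_eq mult.commute)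
      then obtain \<zeta>' where \<zeta>': "unit_map s \<zeta>' = z" "cmod (\<zeta>' - \<zeta>) < \<kappa> * R k / 2"
        using unit_map_nearby[OF s, of u \<zeta>] \<kappa>R(2)[of k] \<zeta>(2) zu by (metis le_less_trans less_trans)
      have nonres: "\<forall>j. 1 \<le> j \<and> j < k \<longrightarrow> unit_map s \<zeta> ^ j \<noteq> 1" if "\<zeta> \<notin> low_fractions k" for \<zeta>
        using unit_map_root_of_unity[OF s _ less_imp_le] that by blast
      have hol': "(\<lambda>\<zeta>. g k (unit_map s \<zeta>)) holomorphic_on - low_fractions k"
      proof -
        have "unit_map s holomorphic_on - low_fractions k"
          unfolding unit_map_def by (intro holomorphic_intros)
        then have "g k \<circ> unit_map s holomorphic_on - low_fractions k"
          by (rule holomorphic_on_compose_gen[OF _ hol]) (use nonres in blast)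
        then show ?thesis
          by (simp add: o_def)
      qed
      have bd': "cmod (g k (unit_map s \<zeta>)) \<le> m k" if "\<zeta> \<in> K_set \<kappa> (M + M / 2)" for \<zeta>
        using bound[of "unit_map s \<zeta>" k] that by (simp add: m_def chart_set_def)
      have approx: "\<exists>x. brjuno x \<le> ereal (M + M / 2) \<and> 0 < of_int \<sigma> * (of_int p / of_int q - x) \<and> R k \<le> of_int \<sigma> * (x - y)"
        if "brjuno y \<le> ereal M" "1 \<le> q" "q \<le> int k" "\<sigma> = 1 \<or> \<sigma> = (-1::int)" "0 < of_int \<sigma> * (of_int p / of_int q - y)" for y p q \<sigma>
        using approx0[OF that] R(3)[of k] by (meson order_trans)
      have "\<zeta>' \<notin> low_fractions k" "cmod (g k z) \<le> m k"
        using K_set_maximum_principle[OF M M2(1) \<kappa> R(1) approx hol' bd' \<zeta>(1) \<zeta>'(2)] \<zeta>'(1) by simp_all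
      then show ?thesis
        using nonres[of \<zeta>'] \<zeta>'(1) by simp
    qed
    have "g k holomorphic_on ball lam (\<rho> k)" if "lam \<in> chart_set s \<kappa> M" "dist lam lam0 < cmod lam0 / 2" for lam k
      using near[OF that] by (intro holomorphic_on_subset[OF hol]) blast
    then show ?thesis
      using \<rho> sm near False
      by (intro exI[of _ "cmod lam0 / 2"] conjI exI[of _ m] exI[of _ \<rho>]) auto
  qed
qed

theorem corollary10:
  fixes f :: "nat \<Rightarrow> complex" and M r :: "nat \<Rightarrow> real" and \<kappa> b1 :: real
  assumes "0 < \<kappa>" and "\<kappa> < 1"
    and "linearization_constant \<kappa> b1"
    and "\<And>lam. lam \<noteq> 0 \<Longrightarrow> univalent_on_unit_disk (germ_family f lam)"
    and "incseq M" and "\<And>j. 0 < M j" and "filterlim M at_top sequentially"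
    and "\<And>j. r j = exp (- (3 * M j + b1))"
  shows "restrict (linearization f) (\<Union>j. C_set \<kappa> (M j)) \<in> monogenic (\<lambda>j. C_set \<kappa> (M j)) r"
proof -
  let ?H = "restrict (linearization f) (\<Union>j. C_set \<kappa> (M j))"
  have const: "ereal (exp (- (N + b1))) \<le> fps_conv_radius (linearization f x)"
    "\<And>k. 1 \<le> k \<Longrightarrow> cmod (fps_nth (linearization f x) k) \<le> exp ((N + b1) * real k)"
    if "0 < N" "x \<in> C_set \<kappa> N" for N x
    using assms(3,4) that unfolding linearization_constant_def by blast+
  have coeff_bound: "cmod (fps_nth (linearization f x) k) \<le> exp ((N + b1) * real k)"
    if "0 < N" "x \<in> C_set \<kappa> N" for N x k
  proof (cases "k = 0")
    case True
    then show ?thesis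
      by (cases x) (auto simp: lin_coeff.simps)
  next
    case False
    then show ?thesis
      using const(2)[OF that, of k] by simp
  qed
  have germ: "?H x \<in> germs" if "x \<in> (\<Union>j. C_set \<kappa> (M j))" for x
  proof -
    from that obtain j where j: "x \<in> C_set \<kappa> (M j)"
      by blast
    have "0 < ereal (exp (- (M j + b1)))"
      by simp
    also have "\<dots> \<le> fps_conv_radius (linearization f x)"
      using const(1)[OF assms(6) j] .
    finally show ?thesis
      using that by (simp add: germs_def)
  qed
  have "?H \<in> C1_hol_sphere (H_inf (r j)) (\<lambda>c F. fps_const c * F) (H_inf_norm (r j)) (C_set \<kappa> (M j))" for j
  proof -
    have N: "0 < M j + M j / 2"
      using assms(6)[of j] by simp
    have r: "0 < r j"
      using assms(8) by simp
    have "?H \<circ> Some \<in> C1_hol (H_inf (r j)) (\<lambda>c F. fps_const c * F) (H_inf_norm (r j)) (Some -` C_set \<kappa> (M j))"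
      unfolding vimage_Some_C_set
    proof (rule C1_hol_power_series[where g = "\<lambda>k lam. lin_coeff f lam k", OF r])
      fix lam k
      assume "lam \<in> chart_set 1 \<kappa> (M j)"
      then have "Some lam \<in> (\<Union>j. C_set \<kappa> (M j))"
        unfolding vimage_Some_C_set[symmetric] by blast
      then show "fps_nth ((?H \<circ> Some) lam) k = lin_coeff f lam k"
        by simp
    next
      fix lam0
      assume lam0: "lam0 \<in> chart_set 1 \<kappa> (M j)"
      have "cmod (lin_coeff f w k) \<le> exp ((M j + M j / 2 + b1) * real k)" if "w \<in> chart_set 1 \<kappa> (M j + M j / 2)" for k w
        using coeff_bound[OF N, of "Some w" k] that unfolding vimage_Some_C_set[symmetric] by simp
      from local_bounds_in_chart[OF disjI1[OF refl] assms(6) assms(1,2) holomorphic_lin_coeff this assms(8) lam0]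
      show "\<exists>\<delta>>0. \<exists>m \<rho>. (\<forall>k. 0 < \<rho> k \<and> \<rho> k \<le> 1) \<and> summable (\<lambda>k. m k / \<rho> k * r j ^ k) \<and>
        (\<forall>lam\<in>chart_set 1 \<kappa> (M j). dist lam lam0 < \<delta> \<longrightarrow>
          (\<forall>k. (\<lambda>lam. lin_coeff f lam k) holomorphic_on ball lam (\<rho> k) \<and>
            (\<forall>z\<in>ball lam (\<rho> k). cmod (lin_coeff f z k) \<le> m k)))" .
    qed
    moreover have "?H \<circ> chart_infinity \<in> C1_hol (H_inf (r j)) (\<lambda>c F. fps_const c * F) (H_inf_norm (r j)) (chart_infinity -` C_set \<kappa> (M j))"
      unfolding vimage_chart_infinity_C_set
    proof (rule C1_hol_power_series[where g = "\<lambda>k w. fps_nth (linearization f (chart_infinity w)) k", OF r])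
      fix w k
      assume "w \<in> chart_set (-1) \<kappa> (M j)"
      then have "chart_infinity w \<in> (\<Union>j. C_set \<kappa> (M j))"
        unfolding vimage_chart_infinity_C_set[symmetric] by blast
      then show "fps_nth ((?H \<circ> chart_infinity) w) k = fps_nth (linearization f (chart_infinity w)) k"
        by simp
    next
      fix lam0
      assume lam0: "lam0 \<in> chart_set (-1) \<kappa> (M j)"
      have "cmod (fps_nth (linearization f (chart_infinity w)) k) \<le> exp ((M j + M j / 2 + b1) * real k)"
        if "w \<in> chart_set (-1) \<kappa> (M j + M j / 2)" for k w
        using coeff_bound[OF N, of "chart_infinity w" k] that unfolding vimage_chart_infinity_C_set[symmetric] by simp
      from local_bounds_in_chart[OF disjI2[OF refl] assms(6) assms(1,2) holomorphic_lin_coeff_infinity this assms(8) lam0]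
      show "\<exists>\<delta>>0. \<exists>m \<rho>. (\<forall>k. 0 < \<rho> k \<and> \<rho> k \<le> 1) \<and> summable (\<lambda>k. m k / \<rho> k * r j ^ k) \<and>
        (\<forall>lam\<in>chart_set (-1) \<kappa> (M j). dist lam lam0 < \<delta> \<longrightarrow>
          (\<forall>k. (\<lambda>w. fps_nth (linearization f (chart_infinity w)) k) holomorphic_on ball lam (\<rho> k) \<and>
            (\<forall>z\<in>ball lam (\<rho> k). cmod (fps_nth (linearization f (chart_infinity z)) k) \<le> m k)))" .
    qed
    ultimately show ?thesis
      by (simp add: C1_hol_sphere_def)
  qed
  then show ?thesis
    unfolding monogenic_def using germ by auto
qed

end
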